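(* Let $n\ge 2$, let $\mathcal{H}_1,\dots,\mathcal{H}_n$ be infinite dimensional complex Hilbert spaces, and let $D_s\in\mathcal{B}(\mathcal{H}_s)$ for $1\le s\le n$. Consider the following statements. (i) Both of the following hold: (a) $D_1\in\Phi_+(\mathcal{H}_1)$; (b) either [$\mathcal{R}(D_s)$ is closed for $2\le s\le n$ and $\alpha(D_s)\le\beta(D_{s-1})$ for $2\le s\le n$], or [$D_s\in\Phi_+(\mathcal{H}_s)$ for $2\le s\le n$]. (ii) There exists $A\in\mathcal{B}_n$ such that $T_n^d(A)\in\Phi_+(\mathcal{H}_1\oplus\cdots\oplus\mathcal{H}_n)$. (iii) Both of the following hold: (a) $D_1\in\Phi_+(\mathcal{H}_1)$; (b) either [there is $j\in\{1,\dots,n-1\}$ such that $\beta(D_j)=\infty$ and $\alpha(D_s)<\infty$ for $2\le s\le j$ (the last condition being omitted if $j=1$)], or [$D_s\in\Phi_+(\mathcal{H}_s)$ for $2\le s\le n$]. Then (i) $\Rightarrow$ (ii) $\Rightarrow$ (iii).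
   Context: $\mathcal{B}(\mathcal{H},\mathcal{K})$ is the space of bounded linear operators from $\mathcal{H}$ to $\mathcal{K}$, and $\mathcal{B}(\mathcal{H})=\mathcal{B}(\mathcal{H},\mathcal{H})$. $\mathcal{N}(T)$ and $\mathcal{R}(T)$ are the kernel and range of $T$. $\mathcal{B}_n$ is the set of all tuples $A=(A_{ij})_{1\le i<j\le n}$ with $A_{ij}\in\mathcal{B}(\mathcal{H}_j,\mathcal{H}_i)$. Given $D_1,\dots,D_n$ and $A\in\mathcal{B}_n$, $T_n^d(A)\in\mathcal{B}(\mathcal{H}_1\oplus\cdots\oplus\mathcal{H}_n)$ is the upper triangular block operator matrix with diagonal entries $D_1,\dots,D_n$, entry $A_{ij}$ in position $(i,j)$ for $i<j$, and $0$ in position $(i,j)$ for $i>j$. For $T\in\mathcal{B}(\mathcal{H})$: $\alpha(T)=\dim\mathcal{N}(T)$ and $\beta(T)=\dim\mathcal{H}/\mathcal{R}(T)$. Dimensions of Hilbert spaces are Hilbert (orthogonal) dimensions, compared as cardinals; thus $\beta(T)$ is the Hilbert dimension of $\mathcal{R}(T)^\perp$ if $\mathcal{R}(T)$ is closed, while if $\mathcal{R}(T)$ is not closed $\beta(T)$ is the algebraic dimension of the quotient, which is infinite. "$=\infty$" means infinite and "$<\infty$" means finite. $\Phi_+(\mathcal{H})=\{T\in\mathcal{B}(\mathcal{H}):\alpha(T)<\infty \text{ and } \mathcal{R}(T)\text{ is closed}\}$. *)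

theory Defs
  imports "HOL-Analysis.Analysis" "HOL-Algebra.Algebraic_Closure_Type"
begin

unbundle cardinal_syntax

text \<open>
  The spaces $H_1,\dots,H_n$ are unrelated Hilbert spaces whose number $n$ is a variable, so a Hilbert
  space is a structure with an explicit carrier rather than a type: a vector space over the complex
  numbers (a module record of HOL-Algebra, whose components \<open>mult\<close> and \<open>one\<close> are not
  used) together with an inner product, linear in its first argument.  All properties and maps are
  relativised to the carriers.  That the carriers of $H_1,\dots,H_n$ are sets over one type is no
  restriction: the type can be a disjoint union.
\<close>

record 'a ip_space = "(complex, 'a) module" +
  cinner :: "'a \<Rightarrow> 'a \<Rightarrow> complex"

definition hnorm :: "'a ip_space \<Rightarrow> 'a \<Rightarrow> real" where
  "hnorm H x = sqrt (Re (cinner H x x))"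

text \<open>
  The value $0$ outside the carrier is needed because the locale \<open>Metric_space\<close> requires a distance
  function to be nonnegative and symmetric on the whole type.
\<close>

definition hdist :: "'a ip_space \<Rightarrow> 'a \<Rightarrow> 'a \<Rightarrow> real" where
  "hdist H x y = (if x \<in> carrier H \<and> y \<in> carrier H then hnorm H (x \<ominus>\<^bsub>H\<^esub> y) else 0)"

locale complex_hilbert_space = module "ring_of_type_algebra :: complex ring" H
  for H :: "'a ip_space" (structure) +
  assumes cinner_add_left: "\<lbrakk>x \<in> carrier H; y \<in> carrier H; z \<in> carrier H\<rbrakk>
      \<Longrightarrow> cinner H (x \<oplus>\<^bsub>H\<^esub> y) z = cinner H x z + cinner H y z"
    and cinner_smult_left: "\<lbrakk>x \<in> carrier H; y \<in> carrier H\<rbrakk>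
      \<Longrightarrow> cinner H (c \<odot>\<^bsub>H\<^esub> x) y = c * cinner H x y"
    and cinner_commute: "\<lbrakk>x \<in> carrier H; y \<in> carrier H\<rbrakk>
      \<Longrightarrow> cinner H y x = cnj (cinner H x y)"
    and cinner_pos: "\<lbrakk>x \<in> carrier H; x \<noteq> \<zero>\<^bsub>H\<^esub>\<rbrakk> \<Longrightarrow> Re (cinner H x x) > 0"
    and complete: "Metric_space.mcomplete (carrier H) (hdist H)"

definition closed_in :: "'a ip_space \<Rightarrow> 'a set \<Rightarrow> bool" where
  "closed_in H S \<longleftrightarrow> closedin (Metric_space.mtopology (carrier H) (hdist H)) S"


definition orthonormal_basis :: "'a ip_space \<Rightarrow> 'a set \<Rightarrow> 'a set \<Rightarrow> bool" where
  \<comment> \<open>For a closed subspace \<open>S\<close> of \<open>H\<close>: a maximal orthonormal subset of \<open>S\<close>.\<close>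
  "orthonormal_basis H S B \<longleftrightarrow>
     B \<subseteq> S \<and>
     (\<forall>x\<in>B. \<forall>y\<in>B. cinner H x y = (if x = y then 1 else 0)) \<and>
     (\<forall>x\<in>S. (\<forall>b\<in>B. cinner H x b = 0) \<longrightarrow> x = \<zero>\<^bsub>H\<^esub>)"

text \<open>
  Dimensions are cardinals in the sense of the HOL cardinal library; they are compared by
  \<open>\<le>o\<close>, and \<open>cinfinite\<close> expresses that they are infinite.  The choice of a basis is
  immaterial, since any two bases are equinumerous.
\<close>

definition hilbert_dim :: "'a ip_space \<Rightarrow> 'a set \<Rightarrow> 'a rel" where
  "hilbert_dim H S = |SOME B. orthonormal_basis H S B|"

definition orth_complement :: "'a ip_space \<Rightarrow> 'a set \<Rightarrow> 'a set" where
  "orth_complement H S = {x \<in> carrier H. \<forall>y\<in>S. cinner H x y = 0}"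

text \<open>
  A Hamel basis of the quotient of \<open>H\<close> by a subspace \<open>M\<close>, given by representatives: \<open>B\<close> is
  such a set if and only if $b \mapsto b + M$ is injective on \<open>B\<close> and maps \<open>B\<close> onto a
  vector space basis of $H/M$.
\<close>

definition quotient_basis :: "'a ip_space \<Rightarrow> 'a set \<Rightarrow> 'a set \<Rightarrow> bool" where
  "quotient_basis H M B \<longleftrightarrow>
     B \<subseteq> carrier H \<and>
     (\<forall>F c. finite F \<and> F \<subseteq> B \<and> (\<Oplus>\<^bsub>H\<^esub>b\<in>F. c b \<odot>\<^bsub>H\<^esub> b) \<in> M \<longrightarrow> (\<forall>b\<in>F. c b = 0)) \<and>
     (\<forall>x\<in>carrier H. \<exists>F c. finite F \<and> F \<subseteq> B \<and> x \<ominus>\<^bsub>H\<^esub> (\<Oplus>\<^bsub>H\<^esub>b\<in>F. c b \<odot>\<^bsub>H\<^esub> b) \<in> M)"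

definition algebraic_codim :: "'a ip_space \<Rightarrow> 'a set \<Rightarrow> 'a rel" where
  "algebraic_codim H M = |SOME B. quotient_basis H M B|"


text \<open>Values of a map outside the carrier of its domain are irrelevant and left arbitrary.\<close>

definition bounded_ops :: "'a ip_space \<Rightarrow> 'b ip_space \<Rightarrow> ('a \<Rightarrow> 'b) set" where
  "bounded_ops H K = {T.
     T \<in> carrier H \<rightarrow> carrier K \<and>
     (\<forall>x\<in>carrier H. \<forall>y\<in>carrier H. T (x \<oplus>\<^bsub>H\<^esub> y) = T x \<oplus>\<^bsub>K\<^esub> T y) \<and>
     (\<forall>c. \<forall>x\<in>carrier H. T (c \<odot>\<^bsub>H\<^esub> x) = c \<odot>\<^bsub>K\<^esub> T x) \<and>
     (\<exists>C. \<forall>x\<in>carrier H. hnorm K (T x) \<le> C * hnorm H x)}"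

definition op_range :: "'a ip_space \<Rightarrow> ('a \<Rightarrow> 'a) \<Rightarrow> 'a set" where
  "op_range H T = T ` carrier H"

definition nullity :: "'a ip_space \<Rightarrow> ('a \<Rightarrow> 'a) \<Rightarrow> 'a rel" where
  "nullity H T = hilbert_dim H (a_kernel H H T)"

text \<open>
  The dimension of $H/R(T)$: the Hilbert dimension of $R(T)^\perp$ if the range is closed, the algebraic
  dimension of the quotient otherwise.
\<close>

definition defect :: "'a ip_space \<Rightarrow> ('a \<Rightarrow> 'a) \<Rightarrow> 'a rel" where
  "defect H T =
     (if closed_in H (op_range H T) then hilbert_dim H (orth_complement H (op_range H T))
      else algebraic_codim H (op_range H T))"

definition upper_semi_fredholm :: "'a ip_space \<Rightarrow> ('a \<Rightarrow> 'a) set" where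
  "upper_semi_fredholm H =
     {T \<in> bounded_ops H H. \<not> cinfinite (nullity H T) \<and> closed_in H (op_range H T)}"


definition direct_sum :: "nat \<Rightarrow> (nat \<Rightarrow> 'a ip_space) \<Rightarrow> (nat \<Rightarrow> 'a) ip_space" where
  "direct_sum n H =
     \<lparr>carrier = (\<Pi>\<^sub>E i\<in>{1..n}. carrier (H i)),
      monoid.mult = undefined,
      one = undefined,
      ring.zero = (\<lambda>i\<in>{1..n}. \<zero>\<^bsub>H i\<^esub>),
      ring.add = (\<lambda>x y. \<lambda>i\<in>{1..n}. x i \<oplus>\<^bsub>H i\<^esub> y i),
      module.smult = (\<lambda>c x. \<lambda>i\<in>{1..n}. c \<odot>\<^bsub>H i\<^esub> x i),
      cinner = (\<lambda>x y. \<Sum>i\<in>{1..n}. cinner (H i) (x i) (y i))\<rparr>"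

definition block_tuples :: "nat \<Rightarrow> (nat \<Rightarrow> 'a ip_space) \<Rightarrow> (nat \<Rightarrow> nat \<Rightarrow> 'a \<Rightarrow> 'a) set" where
  "block_tuples n H = {A. \<forall>i j. 1 \<le> i \<and> i < j \<and> j \<le> n \<longrightarrow> A i j \<in> bounded_ops (H j) (H i)}"

definition upper_entry ::
  "(nat \<Rightarrow> 'a ip_space) \<Rightarrow> (nat \<Rightarrow> 'a \<Rightarrow> 'a) \<Rightarrow> (nat \<Rightarrow> nat \<Rightarrow> 'a \<Rightarrow> 'a) \<Rightarrow> nat \<Rightarrow> nat \<Rightarrow> 'a \<Rightarrow> 'a" where
  "upper_entry H D A i j =
     (if i = j then D i else if i < j then A i j else (\<lambda>x. \<zero>\<^bsub>H i\<^esub>))"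

definition upper_block_operator ::
  "nat \<Rightarrow> (nat \<Rightarrow> 'a ip_space) \<Rightarrow> (nat \<Rightarrow> 'a \<Rightarrow> 'a) \<Rightarrow> (nat \<Rightarrow> nat \<Rightarrow> 'a \<Rightarrow> 'a)
    \<Rightarrow> (nat \<Rightarrow> 'a) \<Rightarrow> (nat \<Rightarrow> 'a)" where
  "upper_block_operator n H D A x =
     (\<lambda>i\<in>{1..n}. \<Oplus>\<^bsub>H i\<^esub>j\<in>{1..n}. upper_entry H D A i j (x j))"

end

theory Submission
  imports Defs
begin

text \<open>
  Everything rests on a description of \<open>\<Phi>\<^sub>+\<close> by sequences: a bounded operator \<open>T\<close> is upper semi-Fredholm if and only
  if every bounded sequence whose image under \<open>T\<close> is Cauchy has a Cauchy subsequence
  (\<open>upper_semi_fredholm_iff\<close>).  For closed range and finite dimensional kernel this holds because \<open>T\<close> is bounded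
  below on the orthogonal complement of its kernel (\<open>closed_range_bounded_below\<close>, a form of the bounded inverse
  theorem), while the components in the kernel have a Cauchy subsequence by Bolzano-Weierstrass.
  Conversely, an infinite orthonormal sequence in the kernel, or unit vectors orthogonal to the kernel with
  images tending to \<open>0\<close>, violate the condition.

  Necessity of (iii).  Suppose that the block operator is upper semi-Fredholm and that \<open>D\<^sub>i\<close> has closed range of
  finite codimension for every \<open>i < k\<close>.  Then \<open>D\<^sub>k\<close> is upper semi-Fredholm
  (\<open>diagonal_entry_cauchy_reflecting\<close>): given a bounded sequence in \<open>H\<^sub>k\<close> with Cauchy image under \<open>D\<^sub>k\<close>, one fills in
  the components \<open>k - 1, ..., 1\<close>, in this order, so that the rows of the image under the block operator
  become Cauchy along a subsequence (\<open>bounded_correction\<close>).  For \<open>k = 1\<close> this is (a).  If some \<open>D\<^sub>s\<close> is not upper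
  semi-Fredholm, take \<open>k\<close> to be the least such index; then some \<open>D\<^sub>j\<close> with \<open>j < k\<close> must have infinite defect, and
  the kernels of \<open>D\<^sub>2, ..., D\<^sub>j\<close> are finite dimensional by minimality of \<open>k\<close>.

  Sufficiency of (i).  If all \<open>D\<^sub>s\<close> are upper semi-Fredholm, the diagonal operator will do.  Otherwise the
  inequality of dimensions provides partial isometries \<open>J\<^sub>s\<close> that embed the kernel of \<open>D\<^sub>s\<close> isometrically into the
  orthogonal complement of the range of \<open>D\<^bsub>s-1\<^esub>\<close> (\<open>partial_isometry_exists\<close>); they are placed next to the
  diagonal.  In each row the two summands are orthogonal, so from a Cauchy image one recovers that
  \<open>D\<^sub>s x\<^sub>s\<close> and \<open>J\<^sub>s x\<^sub>s\<close> are both Cauchy; the former controls the components orthogonal to the kernel and the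
  latter those in the kernel (\<open>hcauchy_if_bounded_below_on_ker\<close>).
\<close>

section \<open>Inner product and norm\<close>

text \<open>
  Completeness is split off because the norm and the metric of a direct sum are needed in order to prove that
  it is complete.
\<close>

locale pre_hilbert = module "ring_of_type_algebra :: complex ring" H
  for H :: "'a ip_space" (structure) +
  assumes cinner_add_left: "\<lbrakk>x \<in> carrier H; y \<in> carrier H; z \<in> carrier H\<rbrakk>
      \<Longrightarrow> cinner H (x \<oplus>\<^bsub>H\<^esub> y) z = cinner H x z + cinner H y z"
    and cinner_smult_left: "\<lbrakk>x \<in> carrier H; y \<in> carrier H\<rbrakk>
      \<Longrightarrow> cinner H (c \<odot>\<^bsub>H\<^esub> x) y = c * cinner H x y"
    and cinner_commute: "\<lbrakk>x \<in> carrier H; y \<in> carrier H\<rbrakk>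
      \<Longrightarrow> cinner H y x = cnj (cinner H x y)"
    and cinner_pos: "\<lbrakk>x \<in> carrier H; x \<noteq> \<zero>\<^bsub>H\<^esub>\<rbrakk> \<Longrightarrow> Re (cinner H x x) > 0"

sublocale complex_hilbert_space \<subseteq> pre_hilbert
  by unfold_locales (auto intro: cinner_add_left cinner_smult_left cinner_commute cinner_pos)

context pre_hilbert
begin

lemma smult_in_carrier [simp, intro]: "x \<in> carrier H \<Longrightarrow> c \<odot> x \<in> carrier H"
  using smult_closed[of c x] by (simp add: ring_of_type_algebra_def)

lemma cinner_zero_left [simp]: "y \<in> carrier H \<Longrightarrow> cinner H \<zero> y = 0"
  using cinner_add_left[of \<zero> \<zero> y] by simp

lemma cinner_zero_right [simp]: "y \<in> carrier H \<Longrightarrow> cinner H y \<zero> = 0"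
  using cinner_commute[of \<zero> y] by simp

lemma cinner_add_right:
  "\<lbrakk>x \<in> carrier H; y \<in> carrier H; z \<in> carrier H\<rbrakk>
    \<Longrightarrow> cinner H z (x \<oplus> y) = cinner H z x + cinner H z y"
  using cinner_commute[of "x \<oplus> y" z] cinner_commute[of x z] cinner_commute[of y z]
  by (simp add: cinner_add_left)

lemma minus_add_cancel: "x \<in> carrier H \<Longrightarrow> y \<in> carrier H \<Longrightarrow> (x \<ominus> y) \<oplus> y = x"
  by (simp add: a_minus_def a_assoc l_neg)

lemma cinner_minus_left:
  assumes "x \<in> carrier H" "y \<in> carrier H" "z \<in> carrier H"
  shows "cinner H (x \<ominus> y) z = cinner H x z - cinner H y z"
proof -
  show ?thesis
    using minus_add_cancel[OF assms(1,2)] cinner_add_left[of "x \<ominus> y" y z] assms by simp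
qed

lemma cinner_minus_right:
  "\<lbrakk>x \<in> carrier H; y \<in> carrier H; z \<in> carrier H\<rbrakk>
    \<Longrightarrow> cinner H z (x \<ominus> y) = cinner H z x - cinner H z y"
  using cinner_commute[of "x \<ominus> y" z] cinner_commute[of x z] cinner_commute[of y z]
  by (simp add: cinner_minus_left)

lemma cinner_smult_right:
  "\<lbrakk>x \<in> carrier H; y \<in> carrier H\<rbrakk> \<Longrightarrow> cinner H x (c \<odot> y) = cnj c * cinner H x y"
  using cinner_commute[of "c \<odot> y" x] cinner_commute[of y x] by (simp add: cinner_smult_left)

lemma cinner_finsum_left:
  assumes "finite F" "f \<in> F \<rightarrow> carrier H" "z \<in> carrier H"
  shows "cinner H (\<Oplus>i\<in>F. f i) z = (\<Sum>i\<in>F. cinner H (f i) z)"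
  using assms(1,2)
proof (induction F)
  case empty
  then show ?case using assms(3) by simp
next
  case (insert i F)
  then have "f \<in> F \<rightarrow> carrier H" "f i \<in> carrier H" by auto
  with insert show ?case
    using assms(3) by (simp add: finsum_insert cinner_add_left)
qed

lemmas cinner_simps = cinner_add_left cinner_add_right cinner_minus_left cinner_minus_right
  cinner_smult_left cinner_smult_right

lemma cinner_self_nonneg: "x \<in> carrier H \<Longrightarrow> Re (cinner H x x) \<ge> 0"
  using cinner_pos[of x] by (cases "x = \<zero>") auto

lemma hnorm_nonneg [simp]: "x \<in> carrier H \<Longrightarrow> hnorm H x \<ge> 0"
  by (simp add: hnorm_def cinner_self_nonneg)

lemma hnorm_zero [simp]: "hnorm H \<zero> = 0"
  by (simp add: hnorm_def)

lemma hnorm_pos: "x \<in> carrier H \<Longrightarrow> x \<noteq> \<zero> \<Longrightarrow> hnorm H x > 0"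
  using cinner_pos[of x] by (auto simp: hnorm_def)

lemma hnorm_eq_0_iff: "x \<in> carrier H \<Longrightarrow> hnorm H x = 0 \<longleftrightarrow> x = \<zero>"
  using hnorm_pos[of x] by fastforce

lemma hnorm_square: "x \<in> carrier H \<Longrightarrow> (hnorm H x)\<^sup>2 = Re (cinner H x x)"
  by (simp add: hnorm_def cinner_self_nonneg)

lemma cinner_self:
  assumes "x \<in> carrier H" shows "cinner H x x = of_real ((hnorm H x)\<^sup>2)"
proof -
  have "cinner H x x = cnj (cinner H x x)" using cinner_commute[OF assms assms] .
  then have "Im (cinner H x x) = 0" by (simp add: complex_eq_iff)
  then show ?thesis by (simp add: hnorm_square[OF assms] complex_eq_iff)
qed

text \<open>
  Inner products separate points, so a linear identity between vectors can be checked as an identity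
  between complex numbers; this replaces most computations in the abelian group.
\<close>

lemma cinner_ext:
  assumes "x \<in> carrier H" "y \<in> carrier H" "\<And>z. z \<in> carrier H \<Longrightarrow> cinner H x z = cinner H y z"
  shows "x = y"
proof -
  have "cinner H (x \<ominus> y) (x \<ominus> y) = 0"
    using assms by (simp add: cinner_minus_left)
  then have "x \<ominus> y = \<zero>"
    using cinner_pos[of "x \<ominus> y"] assms by force
  then show ?thesis
    using minus_add_cancel[OF assms(1,2)] assms by simp
qed

lemma smult_zero [simp]: "c \<odot> \<zero> = \<zero>"
  by (rule cinner_ext) (simp_all add: cinner_smult_left)

lemma minus_self [simp]: "x \<in> carrier H \<Longrightarrow> x \<ominus> x = \<zero>"
  by (rule cinner_ext) (simp_all add: cinner_simps)

lemma minus_eq_zero_iff: "x \<in> carrier H \<Longrightarrow> y \<in> carrier H \<Longrightarrow> x \<ominus> y = \<zero> \<longleftrightarrow> x = y"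
  using minus_add_cancel[of x y] by auto

text \<open>
  The component of \<open>x\<close> orthogonal to \<open>y\<close>.  That its squared norm is nonnegative is the Cauchy-Schwarz inequality;
  that it is shorter than \<open>x\<close> unless \<open>x\<close> is orthogonal to \<open>y\<close> makes best approximations orthogonal.
\<close>

lemma residual_square:
  assumes "x \<in> carrier H" "y \<in> carrier H" "y \<noteq> \<zero>"
  shows "(hnorm H (x \<ominus> (cinner H x y / cinner H y y) \<odot> y))\<^sup>2
    = (hnorm H x)\<^sup>2 - (cmod (cinner H x y))\<^sup>2 / (hnorm H y)\<^sup>2"
proof -
  define a where "a = (hnorm H y)\<^sup>2"
  define b where "b = cinner H x y"
  have a: "a > 0" "cinner H y y = of_real a"
    using hnorm_pos[OF assms(2,3)] cinner_self[OF assms(2)] by (simp_all add: a_def)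
  have yx: "cinner H y x = cnj b"
    using cinner_commute[OF assms(1,2)] by (simp add: b_def)
  let ?z = "x \<ominus> (b / a) \<odot> y"
  have "cinner H ?z ?z = cinner H x x - cnj (b / a) * b - (b / a) * (cnj b - cnj (b / a) * a)"
    using assms a by (simp add: cinner_simps yx b_def[symmetric] algebra_simps)
  also have "\<dots> = cinner H x x - of_real ((cmod b)\<^sup>2 / a)"
    using a(1) complex_norm_square[of b] by (simp add: field_simps)
  finally have "Re (cinner H ?z ?z) = Re (cinner H x x) - (cmod b)\<^sup>2 / a"
    by (simp del: of_real_divide)
  then show ?thesis
    using assms by (simp add: hnorm_square a(2) flip: a_def b_def)
qed

lemma Cauchy_Schwarz:
  assumes "x \<in> carrier H" "y \<in> carrier H"
  shows "cmod (cinner H x y) \<le> hnorm H x * hnorm H y"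
proof (cases "y = \<zero>")
  case False
  have "(cmod (cinner H x y))\<^sup>2 / (hnorm H y)\<^sup>2 \<le> (hnorm H x)\<^sup>2"
    using residual_square[OF assms False] by (metis diff_ge_0_iff_ge zero_le_power2)
  then have "(cmod (cinner H x y))\<^sup>2 \<le> (hnorm H x * hnorm H y)\<^sup>2"
    using hnorm_pos[OF assms(2) False] by (simp add: field_simps power_mult_distrib)
  then show ?thesis
    by (rule power2_le_imp_le) (use assms in simp)
qed (use assms in auto)

lemma hnorm_smult: 
  assumes "x \<in> carrier H" shows "hnorm H (c \<odot> x) = cmod c * hnorm H x"
proof -
  have "cinner H (c \<odot> x) (c \<odot> x) = of_real ((cmod c * hnorm H x)\<^sup>2)"
    using assms complex_norm_square[of c]
    by (simp add: cinner_smult_left cinner_smult_right cinner_self[OF assms] power_mult_distrib)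
  then have "(hnorm H (c \<odot> x))\<^sup>2 = (cmod c * hnorm H x)\<^sup>2"
    using assms by (simp add: hnorm_square del: of_real_power)
  then show ?thesis
    using assms by (simp add: power2_eq_iff_nonneg)
qed

lemma hnorm_add_square:
  assumes "x \<in> carrier H" "y \<in> carrier H"
  shows "(hnorm H (x \<oplus> y))\<^sup>2 = (hnorm H x)\<^sup>2 + 2 * Re (cinner H x y) + (hnorm H y)\<^sup>2"
  using assms cinner_commute[OF assms] by (simp add: hnorm_square cinner_simps)

lemma hnorm_minus_square:
  assumes "x \<in> carrier H" "y \<in> carrier H"
  shows "(hnorm H (x \<ominus> y))\<^sup>2 = (hnorm H x)\<^sup>2 - 2 * Re (cinner H x y) + (hnorm H y)\<^sup>2"
  using assms cinner_commute[OF assms] by (simp add: hnorm_square cinner_simps)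

lemma hnorm_triangle:
  assumes "x \<in> carrier H" "y \<in> carrier H"
  shows "hnorm H (x \<oplus> y) \<le> hnorm H x + hnorm H y"
proof -
  have "Re (cinner H x y) \<le> hnorm H x * hnorm H y"
    using Cauchy_Schwarz[OF assms] complex_Re_le_cmod[of "cinner H x y"] by linarith
  then have "(hnorm H (x \<oplus> y))\<^sup>2 \<le> (hnorm H x + hnorm H y)\<^sup>2"
    by (simp add: hnorm_add_square[OF assms] power2_sum)
  then show ?thesis
    by (rule power2_le_imp_le) (use assms in simp)
qed

lemma hnorm_minus_commute:
  assumes "x \<in> carrier H" "y \<in> carrier H" shows "hnorm H (x \<ominus> y) = hnorm H (y \<ominus> x)"
proof -
  have "x \<ominus> y = (-1) \<odot> (y \<ominus> x)"
    by (rule cinner_ext) (use assms in \<open>simp_all add: cinner_simps\<close>)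
  then show ?thesis using assms by (simp add: hnorm_smult)
qed

lemma hnorm_triangle_via:
  assumes "x \<in> carrier H" "y \<in> carrier H" "z \<in> carrier H"
  shows "hnorm H (x \<ominus> z) \<le> hnorm H (x \<ominus> y) + hnorm H (y \<ominus> z)"
proof -
  have "x \<ominus> z = (x \<ominus> y) \<oplus> (y \<ominus> z)"
    by (rule cinner_ext) (use assms in \<open>simp_all add: cinner_simps\<close>)
  then show ?thesis
    using hnorm_triangle[of "x \<ominus> y" "y \<ominus> z"] assms by simp
qed

lemma minus_zero_right [simp]: "x \<in> carrier H \<Longrightarrow> x \<ominus> \<zero> = x"
  by (rule cinner_ext) (simp_all add: cinner_simps)

lemma hnorm_triangle_ineq2:
  assumes "x \<in> carrier H" "y \<in> carrier H"
  shows "hnorm H x - hnorm H y \<le> hnorm H (x \<ominus> y)"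
  using hnorm_triangle_via[of x y \<zero>] assms by simp

lemma hnorm_finsum_le:
  assumes "finite F" "f \<in> F \<rightarrow> carrier H"
  shows "hnorm H (\<Oplus>i\<in>F. f i) \<le> (\<Sum>i\<in>F. hnorm H (f i))"
  using assms
proof (induction F)
  case (insert i F)
  then have "f \<in> F \<rightarrow> carrier H" "f i \<in> carrier H" by auto
  with insert show ?case
    using hnorm_triangle[of "f i" "\<Oplus>i\<in>F. f i"] by (simp add: finsum_insert)
qed simp

lemma zero_operator_bounded: "(\<lambda>x. \<zero>) \<in> bounded_ops K H"
  by (auto simp: bounded_ops_def intro!: exI[of _ 0])

end

section \<open>Sequences, closed sets and completeness\<close>

definition hconv :: "'a ip_space \<Rightarrow> (nat \<Rightarrow> 'a) \<Rightarrow> 'a \<Rightarrow> bool" where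
  "hconv H x l \<longleftrightarrow> (\<forall>m. x m \<in> carrier H) \<and> l \<in> carrier H
    \<and> (\<lambda>m. hnorm H (x m \<ominus>\<^bsub>H\<^esub> l)) \<longlonglongrightarrow> 0"

definition hcauchy :: "'a ip_space \<Rightarrow> (nat \<Rightarrow> 'a) \<Rightarrow> bool" where
  "hcauchy H x \<longleftrightarrow> (\<forall>m. x m \<in> carrier H)
    \<and> (\<forall>e>0. \<exists>N. \<forall>m\<ge>N. \<forall>k\<ge>N. hnorm H (x m \<ominus>\<^bsub>H\<^esub> x k) < e)"

definition hbounded :: "'a ip_space \<Rightarrow> (nat \<Rightarrow> 'a) \<Rightarrow> bool" where
  "hbounded H x \<longleftrightarrow> (\<forall>m. x m \<in> carrier H) \<and> (\<exists>C. \<forall>m. hnorm H (x m) \<le> C)"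

lemma hconvD: "hconv H x l \<Longrightarrow> x m \<in> carrier H" "hconv H x l \<Longrightarrow> l \<in> carrier H"
  by (simp_all add: hconv_def)

lemma hcauchyD: "hcauchy H x \<Longrightarrow> x m \<in> carrier H"
  by (simp add: hcauchy_def)

lemma hboundedD: "hbounded H x \<Longrightarrow> x m \<in> carrier H"
  by (simp add: hbounded_def)

lemma hcauchy_subseq: "hcauchy H x \<Longrightarrow> strict_mono r \<Longrightarrow> hcauchy H (x \<circ> r)"
  unfolding hcauchy_def o_def by (meson le_trans seq_suble)

lemma hbounded_subseq: "hbounded H x \<Longrightarrow> hbounded H (x \<circ> r)"
  unfolding hbounded_def by auto

lemma hcauchy_dominated:
  assumes "hcauchy H x" "\<And>m. y m \<in> carrier K"
    and le: "\<And>m k. hnorm K (y m \<ominus>\<^bsub>K\<^esub> y k) \<le> C * hnorm H (x m \<ominus>\<^bsub>H\<^esub> x k)"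
    and "pre_hilbert H"
  shows "hcauchy K y"
  unfolding hcauchy_def
proof (intro conjI allI impI)
  interpret H: pre_hilbert H by fact
  fix e :: real assume e: "e > 0"
  define C' where "C' = max C 1"
  have "C' > 0" by (simp add: C'_def)
  with e obtain N where N: "\<And>m k. m \<ge> N \<Longrightarrow> k \<ge> N \<Longrightarrow> hnorm H (x m \<ominus>\<^bsub>H\<^esub> x k) < e / C'"
    using assms(1) unfolding hcauchy_def by (metis divide_pos_pos)
  have "hnorm K (y m \<ominus>\<^bsub>K\<^esub> y k) < e" if "m \<ge> N" "k \<ge> N" for m k
  proof -
    have "C * hnorm H (x m \<ominus>\<^bsub>H\<^esub> x k) \<le> C' * hnorm H (x m \<ominus>\<^bsub>H\<^esub> x k)"
      using hcauchyD[OF assms(1)] by (intro mult_right_mono) (auto simp: C'_def)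
    moreover have "C' * hnorm H (x m \<ominus>\<^bsub>H\<^esub> x k) < e"
      using N[OF that] \<open>C' > 0\<close> by (simp add: field_simps)
    ultimately show ?thesis using le[of m k] by linarith
  qed
  then show "\<exists>N. \<forall>m\<ge>N. \<forall>k\<ge>N. hnorm K (y m \<ominus>\<^bsub>K\<^esub> y k) < e" by blast
qed (use assms in auto)

context pre_hilbert
begin

sublocale metric: Metric_space "carrier H" "hdist H"
proof
  show "0 \<le> hdist H x y" for x y by (simp add: hdist_def)
  show "hdist H x y = hdist H y x" for x y
    using hnorm_minus_commute[of x y] by (auto simp: hdist_def)
  show "hdist H x y = 0 \<longleftrightarrow> x = y" if "x \<in> carrier H" "y \<in> carrier H" for x y
    using that by (simp add: hdist_def hnorm_eq_0_iff minus_eq_zero_iff)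
  show "hdist H x z \<le> hdist H x y + hdist H y z"
    if "x \<in> carrier H" "y \<in> carrier H" "z \<in> carrier H" for x y z
    using that hnorm_triangle_via[of x y z] by (simp add: hdist_def)
qed

lemma hconv_iff_limitin:
  "hconv H x l \<longleftrightarrow> (\<forall>m. x m \<in> carrier H) \<and> limitin metric.mtopology x l sequentially"
  by (auto simp: hconv_def metric.limit_metric_sequentially hdist_def LIMSEQ_iff)

lemma hcauchy_iff_MCauchy: "hcauchy H x \<longleftrightarrow> metric.MCauchy x"
  unfolding hcauchy_def metric.MCauchy_def hdist_def image_subset_iff by (smt (verit) UNIV_I)

lemma hconv_imp_hcauchy: "hconv H x l \<Longrightarrow> hcauchy H x"
  unfolding hcauchy_iff_MCauchy hconv_iff_limitin using metric.convergent_imp_MCauchy by blast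

lemma closed_in_iff_sequential:
  "closed_in H S \<longleftrightarrow> S \<subseteq> carrier H \<and> (\<forall>x l. (\<forall>m. x m \<in> S) \<longrightarrow> hconv H x l \<longrightarrow> l \<in> S)"
  unfolding closed_in_def metric.metric_closedin_iff_sequentially_closed hconv_iff_limitin
  by blast

lemma hconv_cinner:
  assumes "hconv H x l" "z \<in> carrier H"
  shows "(\<lambda>m. cinner H (x m) z) \<longlonglongrightarrow> cinner H l z"
proof -
  have "(\<lambda>m. cinner H (x m) z - cinner H l z) \<longlonglongrightarrow> 0"
  proof (rule Lim_null_comparison)
    show "\<forall>\<^sub>F m in sequentially.
        norm (cinner H (x m) z - cinner H l z) \<le> hnorm H (x m \<ominus> l) * hnorm H z"
      using Cauchy_Schwarz[of "x m \<ominus> l" z for m] assms hconvD[OF assms(1)]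
      by (auto simp: cinner_minus_left)
    show "(\<lambda>m. hnorm H (x m \<ominus> l) * hnorm H z) \<longlonglongrightarrow> 0"
      using assms(1) by (auto simp: hconv_def intro: tendsto_mult_left_zero)
  qed
  then show ?thesis by (simp add: LIM_zero_iff)
qed

lemma hconv_hnorm:
  assumes "hconv H x l" shows "(\<lambda>m. hnorm H (x m)) \<longlonglongrightarrow> hnorm H l"
proof -
  have "(\<lambda>m. hnorm H (x m) - hnorm H l) \<longlonglongrightarrow> 0"
  proof (rule Lim_null_comparison)
    show "\<forall>\<^sub>F m in sequentially. norm (hnorm H (x m) - hnorm H l) \<le> hnorm H (x m \<ominus> l)"
      using hnorm_triangle_ineq2[of "x m" l for m] hnorm_triangle_ineq2[of l "x m" for m]
        hnorm_minus_commute[of l "x m" for m] hconvD[OF assms]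
      by (auto simp: abs_le_iff)
    show "(\<lambda>m. hnorm H (x m \<ominus> l)) \<longlonglongrightarrow> 0"
      using assms by (auto simp: hconv_def)
  qed
  then show ?thesis by (simp add: LIM_zero_iff)
qed

lemma hconv_unique:
  assumes "hconv H x l" "hconv H x l'" shows "l = l'"
proof (rule cinner_ext)
  show "cinner H l z = cinner H l' z" if "z \<in> carrier H" for z
    using hconv_cinner[OF assms(1) that] hconv_cinner[OF assms(2) that] by (rule LIMSEQ_unique)
qed (use assms in \<open>auto dest: hconvD\<close>)

lemma hcauchy_add:
  assumes "hcauchy H x" "hcauchy H y" shows "hcauchy H (\<lambda>m. x m \<oplus> y m)"
  unfolding hcauchy_def
proof (intro conjI allI impI)
  note [simp] = hcauchyD[OF assms(1)] hcauchyD[OF assms(2)]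
  show "x m \<oplus> y m \<in> carrier H" for m by simp
  fix e :: real assume "e > 0"
  then obtain N1 N2 where N: "\<And>m k. m \<ge> N1 \<Longrightarrow> k \<ge> N1 \<Longrightarrow> hnorm H (x m \<ominus> x k) < e / 2"
    "\<And>m k. m \<ge> N2 \<Longrightarrow> k \<ge> N2 \<Longrightarrow> hnorm H (y m \<ominus> y k) < e / 2"
    using assms unfolding hcauchy_def by (metis half_gt_zero)
  have eq: "(x m \<oplus> y m) \<ominus> (x k \<oplus> y k) = (x m \<ominus> x k) \<oplus> (y m \<ominus> y k)" for m k
    by (rule cinner_ext) (simp_all add: cinner_simps)
  have "hnorm H ((x m \<oplus> y m) \<ominus> (x k \<oplus> y k)) < e" if "m \<ge> max N1 N2" "k \<ge> max N1 N2" for m k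
    using N(1)[of m k] N(2)[of m k] that hnorm_triangle[of "x m \<ominus> x k" "y m \<ominus> y k"]
    by (simp add: eq)
  then show "\<exists>N. \<forall>m\<ge>N. \<forall>k\<ge>N. hnorm H ((x m \<oplus> y m) \<ominus> (x k \<oplus> y k)) < e" by blast
qed

lemma hcauchy_smult:
  assumes "hcauchy H x" shows "hcauchy H (\<lambda>m. c \<odot> x m)"
proof (rule hcauchy_dominated[OF assms])
  note [simp] = hcauchyD[OF assms(1)]
  show "c \<odot> x m \<in> carrier H" for m by simp
  have "c \<odot> x m \<ominus> c \<odot> x k = c \<odot> (x m \<ominus> x k)" for m k
    by (rule cinner_ext) (simp_all add: cinner_simps algebra_simps)
  then show "hnorm H (c \<odot> x m \<ominus> c \<odot> x k) \<le> cmod c * hnorm H (x m \<ominus> x k)" for m k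
    by (simp add: hnorm_smult)
  show "pre_hilbert H" by (rule pre_hilbert_axioms)
qed

lemma minus_eq_smult:
  "x \<in> carrier H \<Longrightarrow> y \<in> carrier H \<Longrightarrow> x \<ominus> y = x \<oplus> (-1) \<odot> y"
  by (rule cinner_ext) (simp_all add: cinner_simps)

lemma hcauchy_minus:
  assumes "hcauchy H x" "hcauchy H y" shows "hcauchy H (\<lambda>m. x m \<ominus> y m)"
  using hcauchy_add[OF assms(1) hcauchy_smult[OF assms(2), of "-1"]]
    hcauchyD[OF assms(1)] hcauchyD[OF assms(2)]
  by (simp add: minus_eq_smult)

lemma hbounded_add:
  assumes "hbounded H x" "hbounded H y" shows "hbounded H (\<lambda>m. x m \<oplus> y m)"
proof -
  obtain C C' where "\<And>m. hnorm H (x m) \<le> C" "\<And>m. hnorm H (y m) \<le> C'"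
    using assms unfolding hbounded_def by blast
  moreover note hboundedD[OF assms(1)] hboundedD[OF assms(2)]
  ultimately have "hnorm H (x m \<oplus> y m) \<le> C + C'" for m
    using hnorm_triangle[of "x m" "y m"] by (meson add_mono order_trans)
  then show ?thesis
    using hboundedD[OF assms(1)] hboundedD[OF assms(2)] unfolding hbounded_def by blast
qed

lemma hcauchy_const [simp]: "l \<in> carrier H \<Longrightarrow> hcauchy H (\<lambda>_. l)"
  by (simp add: hcauchy_def)

lemma closed_in_limit:
  "closed_in H S \<Longrightarrow> hconv H x l \<Longrightarrow> (\<And>m. x m \<in> S) \<Longrightarrow> l \<in> S"
  by (auto simp: closed_in_iff_sequential)

text \<open>
  Domination by finitely many null double sequences; it covers both coordinate vectors and the components
  of a direct sum.
\<close>

lemma hcauchy_if_sum_dominated: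
  assumes "finite I" "\<And>m. y m \<in> carrier H"
    and small: "\<And>i e::real. i \<in> I \<Longrightarrow> e > 0 \<Longrightarrow> \<exists>N. \<forall>m\<ge>N. \<forall>k\<ge>N. d i m k < e"
    and le: "\<And>m k. hnorm H (y m \<ominus> y k) \<le> (\<Sum>i\<in>I. d i m k)"
  shows "hcauchy H y"
  unfolding hcauchy_def
proof (intro conjI allI impI)
  fix e :: real assume e: "e > 0"
  \<comment> \<open>The summand \<open>1\<close> covers the case of an empty index set.\<close>
  define e' where "e' = e / (real (card I) + 1)"
  have e': "e' > 0" using e by (simp add: e'_def)
  have "\<forall>i\<in>I. \<exists>N. \<forall>m\<ge>N. \<forall>k\<ge>N. d i m k < e'" using small e' by blast
  then obtain N where "\<forall>i\<in>I. \<forall>m\<ge>N i. \<forall>k\<ge>N i. d i m k < e'" by (rule bchoice[THEN exE])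
  then have N: "\<And>i m k. \<lbrakk>i \<in> I; m \<ge> N i; k \<ge> N i\<rbrakk> \<Longrightarrow> d i m k < e'" by blast
  define M where "M = (\<Sum>i\<in>I. N i)"
  have NM: "N i \<le> M" if "i \<in> I" for i
    unfolding M_def using that assms(1) by (intro member_le_sum) auto
  have "hnorm H (y m \<ominus> y k) < e" if mk: "m \<ge> M" "k \<ge> M" for m k
  proof -
    have "d i m k \<le> e'" if "i \<in> I" for i
      using N[OF that, of m k] NM[OF that] mk by simp
    then have "(\<Sum>i\<in>I. d i m k) \<le> (\<Sum>i\<in>I. e')" by (intro sum_mono)
    also have "\<dots> < e" using e by (simp add: e'_def field_simps)
    finally show ?thesis using le[of m k] by linarith
  qed
  then show "\<exists>N. \<forall>m\<ge>N. \<forall>k\<ge>N. hnorm H (y m \<ominus> y k) < e" by blast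
qed (use assms in auto)

lemma hcauchy_orthogonal_summands:
  assumes "hcauchy H (\<lambda>m. u m \<oplus> v m)"
    and "\<And>m. u m \<in> carrier H" "\<And>m. v m \<in> carrier H" "\<And>m k. cinner H (u m) (v k) = 0"
  shows "hcauchy H u" "hcauchy H v"
proof -
  note [simp] = assms(2,3)
  have eq: "(u m \<oplus> v m) \<ominus> (u k \<oplus> v k) = (u m \<ominus> u k) \<oplus> (v m \<ominus> v k)" for m k
    by (rule cinner_ext) (simp_all add: cinner_simps)
  have "(hnorm H ((u m \<oplus> v m) \<ominus> (u k \<oplus> v k)))\<^sup>2
      = (hnorm H (u m \<ominus> u k))\<^sup>2 + (hnorm H (v m \<ominus> v k))\<^sup>2" for m k
    by (simp add: eq hnorm_add_square cinner_minus_left cinner_minus_right assms(4))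
  then have "(hnorm H (u m \<ominus> u k))\<^sup>2 \<le> (hnorm H ((u m \<oplus> v m) \<ominus> (u k \<oplus> v k)))\<^sup>2"
    "(hnorm H (v m \<ominus> v k))\<^sup>2 \<le> (hnorm H ((u m \<oplus> v m) \<ominus> (u k \<oplus> v k)))\<^sup>2" for m k
    by simp_all
  then have "hnorm H (u m \<ominus> u k) \<le> hnorm H ((u m \<oplus> v m) \<ominus> (u k \<oplus> v k))"
    "hnorm H (v m \<ominus> v k) \<le> hnorm H ((u m \<oplus> v m) \<ominus> (u k \<oplus> v k))" for m k
    by (auto intro: power2_le_imp_le)
  then show "hcauchy H u" "hcauchy H v"
    using hcauchy_dominated[OF assms(1), of _ H 1] pre_hilbert_axioms by simp_all
qed

end

context complex_hilbert_space
begin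

lemma hcauchy_imp_hconv: "hcauchy H x \<Longrightarrow> \<exists>l. hconv H x l"
  using complete unfolding metric.mcomplete_def hconv_iff_limitin hcauchy_iff_MCauchy
  by (auto simp: metric.MCauchy_def)

end

section \<open>Subspaces, orthogonal projection and Riesz representation\<close>

definition linear_subspace :: "'a ip_space \<Rightarrow> 'a set \<Rightarrow> bool" where
  "linear_subspace H S \<longleftrightarrow> S \<subseteq> carrier H \<and> \<zero>\<^bsub>H\<^esub> \<in> S
    \<and> (\<forall>x\<in>S. \<forall>y\<in>S. x \<oplus>\<^bsub>H\<^esub> y \<in> S) \<and> (\<forall>c. \<forall>x\<in>S. c \<odot>\<^bsub>H\<^esub> x \<in> S)"

context complex_hilbert_space
begin

lemma linear_subspaceD:
  assumes "linear_subspace H S"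
  shows "S \<subseteq> carrier H" "\<zero> \<in> S" "\<lbrakk>x \<in> S; y \<in> S\<rbrakk> \<Longrightarrow> x \<oplus> y \<in> S" "x \<in> S \<Longrightarrow> c \<odot> x \<in> S"
    "\<lbrakk>x \<in> S; y \<in> S\<rbrakk> \<Longrightarrow> x \<ominus> y \<in> S"
proof -
  show *: "S \<subseteq> carrier H" "\<zero> \<in> S" "\<lbrakk>x \<in> S; y \<in> S\<rbrakk> \<Longrightarrow> x \<oplus> y \<in> S" "x \<in> S \<Longrightarrow> c \<odot> x \<in> S" for x y c
    using assms by (auto simp: linear_subspace_def)
  show "x \<ominus> y \<in> S" if "x \<in> S" "y \<in> S"
    using *(3)[OF that(1) *(4)[OF that(2), of "-1"]] that *(1) by (simp add: minus_eq_smult subset_iff)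
qed

lemma finsum_in_subspace:
  assumes "linear_subspace H S" "finite F" "f \<in> F \<rightarrow> S"
  shows "(\<Oplus>i\<in>F. f i) \<in> S"
  using assms(2,3)
proof (induction F)
  case (insert i F)
  then have "f \<in> F \<rightarrow> carrier H" "f i \<in> carrier H" "f \<in> F \<rightarrow> S" "f i \<in> S"
    using linear_subspaceD(1)[OF assms(1)] by auto
  with insert show ?case
    using linear_subspaceD(3)[OF assms(1)] by (simp add: finsum_insert)
qed (simp add: linear_subspaceD(2)[OF assms(1)])

lemma linear_subspace_carrier [simp]: "linear_subspace H (carrier H)"
  by (simp add: linear_subspace_def)

lemma orth_complement_subspace:
  "S \<subseteq> carrier H \<Longrightarrow> linear_subspace H (orth_complement H S)"
  by (auto simp: linear_subspace_def orth_complement_def cinner_simps subset_iff)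

lemma orth_complement_closed:
  assumes "S \<subseteq> carrier H"
  shows "closed_in H (orth_complement H S)"
  unfolding closed_in_iff_sequential
proof (intro conjI allI impI)
  fix x l assume x: "\<forall>m. x m \<in> orth_complement H S" "hconv H x l"
  have "cinner H l y = 0" if "y \<in> S" for y
  proof -
    have "(\<lambda>m. cinner H (x m) y) \<longlonglongrightarrow> cinner H l y"
      using hconv_cinner[OF x(2)] that assms by blast
    moreover have "cinner H (x m) y = 0" for m
      using x(1) that by (auto simp: orth_complement_def)
    ultimately show ?thesis by (simp add: LIMSEQ_const_iff)
  qed
  then show "l \<in> orth_complement H S"
    using hconvD[OF x(2)] by (simp add: orth_complement_def)
qed (auto simp: orth_complement_def)

lemma parallelogram_midpoint:
  assumes "x \<in> carrier H" "s \<in> carrier H" "t \<in> carrier H"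
  shows "(hnorm H (s \<ominus> t))\<^sup>2 = 2 * (hnorm H (x \<ominus> s))\<^sup>2 + 2 * (hnorm H (x \<ominus> t))\<^sup>2
    - 4 * (hnorm H (x \<ominus> (1/2) \<odot> (s \<oplus> t)))\<^sup>2"
proof -
  have "cinner H x s + cinner H s x = 2 * Re (cinner H x s)"
    "cinner H x t + cinner H t x = 2 * Re (cinner H x t)"
    using cinner_commute[of x s] cinner_commute[of x t] assms by (simp_all add: complex_add_cnj)
  then have "Re (cinner H s x) = Re (cinner H x s)" "Re (cinner H t x) = Re (cinner H x t)"
    "Re (cinner H t s) = Re (cinner H s t)"
    using cinner_commute[of x s] cinner_commute[of x t] cinner_commute[of s t] assms by simp_all
  then show ?thesis
    using assms by (simp add: hnorm_square cinner_simps algebra_simps)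
qed

text \<open>
  A minimising sequence for the distance from \<open>x\<close> to \<open>S\<close> is Cauchy by the parallelogram law, and its
  limit is the foot of the perpendicular.
\<close>

lemma projection_exists:
  assumes S: "linear_subspace H S" "closed_in H S" and x: "x \<in> carrier H"
  obtains p where "p \<in> S" "\<And>s. s \<in> S \<Longrightarrow> cinner H (x \<ominus> p) s = 0"
proof -
  note SD = linear_subspaceD[OF S(1)]
  have SC: "s \<in> carrier H" if "s \<in> S" for s using SD(1) that by blast
  define A where "A = (\<lambda>s. hnorm H (x \<ominus> s)) ` S"
  define d where "d = Inf A"
  have A: "A \<noteq> {}" "bdd_below A"
    using SD(2) SC x by (auto simp: A_def intro!: bdd_belowI2[where m=0])
  have d_le: "d \<le> hnorm H (x \<ominus> s)" if "s \<in> S" for s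
    unfolding d_def using A(2) that by (intro cInf_lower) (auto simp: A_def)
  have d0: "d \<ge> 0"
    unfolding d_def using A(1) SC x by (intro cInf_greatest) (auto simp: A_def)
  have "\<exists>s\<in>S. hnorm H (x \<ominus> s) < d + inverse (real (Suc m))" for m
  proof -
    have "Inf A < d + inverse (real (Suc m))" by (simp add: d_def)
    then obtain a where "a \<in> A" "a < d + inverse (real (Suc m))"
      using cInf_lessD A(1) by blast
    then show ?thesis by (auto simp: A_def)
  qed
  then obtain s where s: "\<And>m. s m \<in> S" "\<And>m. hnorm H (x \<ominus> s m) < d + inverse (real (Suc m))"
    by metis
  have est: "(hnorm H (s m \<ominus> s k))\<^sup>2 \<le> 2 * (d + inverse (real (Suc m)))\<^sup>2
      + 2 * (d + inverse (real (Suc k)))\<^sup>2 - 4 * d\<^sup>2" for m k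
  proof -
    have "(hnorm H (x \<ominus> s j))\<^sup>2 \<le> (d + inverse (real (Suc j)))\<^sup>2" for j
      using s(2)[of j] SC[OF s(1)[of j]] x by (intro power_mono) auto
    note this[of m] this[of k]
    moreover have "(1/2) \<odot> (s m \<oplus> s k) \<in> S" by (intro SD(4) SD(3) s(1))
    then have "d\<^sup>2 \<le> (hnorm H (x \<ominus> (1/2) \<odot> (s m \<oplus> s k)))\<^sup>2"
      using d_le d0 by (intro power_mono) auto
    ultimately show ?thesis
      using parallelogram_midpoint[of x "s m" "s k"] SC[OF s(1)] x by auto
  qed
  have "hcauchy H s"
    unfolding hcauchy_def
  proof (intro conjI allI impI)
    fix e :: real assume e: "e > 0"
    have "(\<lambda>m. 4 * (d + inverse (real (Suc m)))\<^sup>2 - 4 * d\<^sup>2) \<longlonglongrightarrow> 4 * (d + 0)\<^sup>2 - 4 * d\<^sup>2"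
      by (intro tendsto_intros LIMSEQ_inverse_real_of_nat)
    then have "\<forall>\<^sub>F m in sequentially. 4 * (d + inverse (real (Suc m)))\<^sup>2 - 4 * d\<^sup>2 < e\<^sup>2"
      using e by (intro order_tendstoD(2)) auto
    then obtain N where N: "4 * (d + inverse (real (Suc m)))\<^sup>2 - 4 * d\<^sup>2 < e\<^sup>2" if "m \<ge> N" for m
      by (auto simp: eventually_sequentially)
    have "hnorm H (s m \<ominus> s k) < e" if "m \<ge> N" "k \<ge> N" for m k
    proof (rule power2_less_imp_less)
      show "(hnorm H (s m \<ominus> s k))\<^sup>2 < e\<^sup>2"
        using est[of m k] N[OF that(1)] N[OF that(2)] by linarith
    qed (use e in auto)
    then show "\<exists>N. \<forall>m\<ge>N. \<forall>k\<ge>N. hnorm H (s m \<ominus> s k) < e" by blast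
  qed (use s SC in auto)
  then obtain p where p: "hconv H s p" using hcauchy_imp_hconv by blast
  have pS: "p \<in> S" using S(2) s(1) p by (auto simp: closed_in_iff_sequential)
  have xp: "hnorm H (x \<ominus> p) \<le> d"
  proof (rule LIMSEQ_le_const)
    show "(\<lambda>m. d + inverse (real (Suc m)) + hnorm H (s m \<ominus> p)) \<longlonglongrightarrow> d"
      using tendsto_add[OF tendsto_add[OF tendsto_const LIMSEQ_inverse_real_of_nat]] p
      by (fastforce simp: hconv_def)
    have "hnorm H (x \<ominus> p) \<le> d + inverse (real (Suc m)) + hnorm H (s m \<ominus> p)" for m
      using hnorm_triangle_via[of x "s m" p] s(2)[of m] SC[OF s(1)[of m]] SC[OF pS] x by linarith
    then show "\<exists>N. \<forall>m\<ge>N. hnorm H (x \<ominus> p) \<le> d + inverse (real (Suc m)) + hnorm H (s m \<ominus> p)" by blast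
  qed
  have "cinner H (x \<ominus> p) t = 0" if t: "t \<in> S" for t
  proof (cases "t = \<zero>")
    case False
    define c where "c = cinner H (x \<ominus> p) t / cinner H t t"
    have "(x \<ominus> p) \<ominus> c \<odot> t = x \<ominus> (p \<oplus> c \<odot> t)"
      by (rule cinner_ext) (use x SC[OF pS] SC[OF t] in \<open>simp_all add: cinner_simps\<close>)
    moreover have "d \<le> hnorm H (x \<ominus> (p \<oplus> c \<odot> t))"
      by (intro d_le SD(3,4) pS t)
    ultimately have "(hnorm H (x \<ominus> p))\<^sup>2 \<le> (hnorm H ((x \<ominus> p) \<ominus> c \<odot> t))\<^sup>2"
      using xp x SC[OF pS] by (intro power_mono) auto
    then have "(cmod (cinner H (x \<ominus> p) t))\<^sup>2 / (hnorm H t)\<^sup>2 \<le> 0"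
      using residual_square[of "x \<ominus> p" t] False x SC[OF pS] SC[OF t] unfolding c_def by simp
    then show ?thesis
      using hnorm_pos[OF SC[OF t] False] by (simp add: divide_le_0_iff)
  qed (use x SC[OF pS] in simp)
  with pS show ?thesis by (rule that)
qed

lemma orth_complement_twice:
  assumes S: "linear_subspace H S" "closed_in H S" and x: "x \<in> carrier H"
    and orth: "\<And>y. y \<in> orth_complement H S \<Longrightarrow> cinner H x y = 0"
  shows "x \<in> S"
proof -
  obtain p where p: "p \<in> S" "\<And>s. s \<in> S \<Longrightarrow> cinner H (x \<ominus> p) s = 0"
    using projection_exists[OF assms(1-3)] by blast
  have pc: "p \<in> carrier H" using p(1) linear_subspaceD(1)[OF S(1)] by blast
  have "x \<ominus> p \<in> orth_complement H S" using p x pc by (simp add: orth_complement_def)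
  moreover have "cinner H p (x \<ominus> p) = 0"
    using p(2)[OF p(1)] cinner_commute[of "x \<ominus> p" p] x pc by simp
  ultimately have "cinner H (x \<ominus> p) (x \<ominus> p) = 0"
    using orth[of "x \<ominus> p"] x pc by (simp add: cinner_minus_left)
  then have "x \<ominus> p = \<zero>"
    using cinner_pos[of "x \<ominus> p"] x pc by force
  then show ?thesis using p(1) x pc by (simp add: minus_eq_zero_iff)
qed

text \<open>
  A vector orthogonal to the kernel of a nonzero functional spans a complement of the kernel; rescaled, it
  represents the functional.
\<close>

lemma Riesz:
  assumes add: "\<And>x y. \<lbrakk>x \<in> carrier H; y \<in> carrier H\<rbrakk> \<Longrightarrow> \<phi> (x \<oplus> y) = \<phi> x + \<phi> y"
    and smult: "\<And>c x. x \<in> carrier H \<Longrightarrow> \<phi> (c \<odot> x) = c * \<phi> x"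
    and bounded: "\<And>x. x \<in> carrier H \<Longrightarrow> cmod (\<phi> x) \<le> C * hnorm H x"
  obtains y where "y \<in> carrier H" "\<And>x. x \<in> carrier H \<Longrightarrow> \<phi> x = cinner H x y"
proof -
  define N where "N = {x \<in> carrier H. \<phi> x = 0}"
  have minus: "\<phi> (x \<ominus> y) = \<phi> x - \<phi> y" if "x \<in> carrier H" "y \<in> carrier H" for x y
    using that add[of x "(-1) \<odot> y"] smult[of y "-1"] by (simp add: minus_eq_smult)
  have "\<phi> (\<zero> \<oplus> \<zero>) = \<phi> \<zero> + \<phi> \<zero>" by (rule add) auto
  then have \<phi>0: "\<phi> \<zero> = 0" by (metis add_cancel_left_left r_zero zero_closed)
  have N: "linear_subspace H N"
    unfolding linear_subspace_def N_def using \<phi>0 by (auto simp: add smult)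
  have "closed_in H N"
    unfolding closed_in_iff_sequential
  proof (intro conjI allI impI)
    fix x l assume x: "\<forall>m. x m \<in> N" and conv: "hconv H x l"
    have "cmod (\<phi> l) \<le> C * hnorm H (x m \<ominus> l)" for m
      using bounded[of "x m \<ominus> l"] x minus[of "x m" l] hconvD[OF conv] by (auto simp: N_def)
    moreover have "(\<lambda>m. C * hnorm H (x m \<ominus> l)) \<longlonglongrightarrow> C * 0"
      using conv by (intro tendsto_intros) (simp add: hconv_def)
    ultimately have "cmod (\<phi> l) \<le> C * 0"
      by (intro LIMSEQ_le_const) auto
    then show "l \<in> N" using hconvD(2)[OF conv] by (simp add: N_def)
  qed (auto simp: N_def)
  show ?thesis
  proof (cases "N = carrier H")
    case True
    then show ?thesis using that[of \<zero>] by (auto simp: N_def)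
  next
    case False
    then obtain v where v: "v \<in> carrier H" "\<phi> v \<noteq> 0" by (auto simp: N_def)
    obtain p where p: "p \<in> N" "\<And>s. s \<in> N \<Longrightarrow> cinner H (v \<ominus> p) s = 0"
      using projection_exists[OF N \<open>closed_in H N\<close> v(1)] by blast
    define w where "w = v \<ominus> p"
    have pc: "p \<in> carrier H" "\<phi> p = 0" using p(1) by (auto simp: N_def)
    then have w: "w \<in> carrier H" "\<phi> w \<noteq> 0" using v by (auto simp: w_def minus)
    then have w0: "w \<noteq> \<zero>" using \<phi>0 by auto
    define y where "y = cnj (\<phi> w / cinner H w w) \<odot> w"
    have "\<phi> x = cinner H x y" if x: "x \<in> carrier H" for x
    proof -
      have "x \<ominus> (\<phi> x / \<phi> w) \<odot> w \<in> N" using x w by (simp add: N_def minus smult)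
      then have "cinner H w (x \<ominus> (\<phi> x / \<phi> w) \<odot> w) = 0" using p(2) by (simp add: w_def)
      then have "cinner H (x \<ominus> (\<phi> x / \<phi> w) \<odot> w) w = 0"
        using cinner_commute[of w "x \<ominus> (\<phi> x / \<phi> w) \<odot> w"] x w by simp
      then have "cinner H x w = \<phi> x / \<phi> w * cinner H w w"
        using x w by (simp add: cinner_simps)
      moreover have "cinner H w w \<noteq> 0" using cinner_pos[OF w(1) w0] by auto
      ultimately show ?thesis using x w by (simp add: y_def cinner_simps)
    qed
    moreover have "y \<in> carrier H" using w by (simp add: y_def)
    ultimately show ?thesis using that by blast
  qed
qed

end

section \<open>Orthonormal sets\<close>

lemma common_subsequence:
  assumes "finite I"
    and refine: "\<And>i r. i \<in> I \<Longrightarrow> strict_mono r \<Longrightarrow> \<exists>r'::nat \<Rightarrow> nat. strict_mono r' \<and> P i (r \<circ> r')"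
    and inherit: "\<And>i r r'. P i r \<Longrightarrow> strict_mono r' \<Longrightarrow> P i (r \<circ> r')"
  shows "\<exists>r::nat \<Rightarrow> nat. strict_mono r \<and> (\<forall>i\<in>I. P i r)"
  using assms(1,2)
proof (induction I)
  case empty
  have "strict_mono (\<lambda>m::nat. m)" by (simp add: strict_mono_def)
  then show ?case by blast
next
  case (insert i I)
  then obtain r where r: "strict_mono r" "\<forall>i\<in>I. P i r" by blast
  obtain r' where r': "strict_mono r'" "P i (r \<circ> r')"
    using insert.prems[of i r] r(1) by blast
  then show ?case
    using strict_mono_o[OF r(1) r'(1)] r(2) inherit by blast
qed

context complex_hilbert_space
begin

definition orthonormal :: "'a set \<Rightarrow> bool" where
  "orthonormal B \<longleftrightarrow> B \<subseteq> carrier H \<and> (\<forall>x\<in>B. \<forall>y\<in>B. cinner H x y = (if x = y then 1 else 0))"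

text \<open>
  Since the dimension is defined through a choice of basis, existence of a basis is what gives it a meaning;
  bases come from Zorn's lemma.
\<close>

lemma hilbert_dim_basis:
  assumes "S \<subseteq> carrier H" "\<And>c x. x \<in> S \<Longrightarrow> c \<odot> x \<in> S"
  obtains B where "orthonormal_basis H S B" "hilbert_dim H S = |B|"
proof -
  define C where "C = {B. B \<subseteq> S \<and> orthonormal B}"
  have "\<exists>Y\<in>C. \<forall>Z\<in>C. Y \<subseteq> Z \<longrightarrow> Z = Y"
  proof (rule subset_Zorn_nonempty)
    show "C \<noteq> {}" by (auto simp: C_def orthonormal_def)
    fix \<C> assume "\<C> \<noteq> {}" and ch: "subset.chain C \<C>"
    then have sub: "\<C> \<subseteq> C" and total: "\<And>Y Z. Y \<in> \<C> \<Longrightarrow> Z \<in> \<C> \<Longrightarrow> Y \<subseteq> Z \<or> Z \<subseteq> Y"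
      by (auto simp: subset_chain_def)
    have "cinner H x y = (if x = y then 1 else 0)" if xy: "x \<in> Y" "Y \<in> \<C>" "y \<in> Z" "Z \<in> \<C>" for x y Y Z
    proof -
      obtain W where W: "W \<in> \<C>" "x \<in> W" "y \<in> W"
        using total[OF xy(2,4)] xy by blast
      then have "orthonormal W" using sub by (auto simp: C_def)
      with W show ?thesis by (simp add: orthonormal_def)
    qed
    moreover have "\<Union>\<C> \<subseteq> S" using sub by (auto simp: C_def)
    ultimately show "\<Union>\<C> \<in> C"
      using assms(1) unfolding C_def orthonormal_def by simp
  qed
  then obtain B where B: "B \<subseteq> S" "orthonormal B"
    and max: "\<And>Z. Z \<subseteq> S \<Longrightarrow> orthonormal Z \<Longrightarrow> B \<subseteq> Z \<Longrightarrow> Z = B"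
    by (auto simp: C_def)
  have "x = \<zero>" if x: "x \<in> S" and orth: "\<forall>b\<in>B. cinner H x b = 0" for x
  proof (rule ccontr)
    assume "x \<noteq> \<zero>"
    have xc: "x \<in> carrier H" using x assms(1) by blast
    define u where "u = (1 / hnorm H x) \<odot> x"
    have n: "hnorm H x > 0" using hnorm_pos[OF xc \<open>x \<noteq> \<zero>\<close>] .
    have "cinner H u u = complex_of_real ((hnorm H x)\<^sup>2 / (hnorm H x * hnorm H x))"
      using xc by (simp add: u_def cinner_smult_left cinner_smult_right cinner_self[OF xc])
    then have uu: "cinner H u u = 1"
      using n by (simp add: power2_eq_square)
    have ub: "cinner H u b = 0 \<and> cinner H b u = 0" if "b \<in> B" for b
      using that orth xc assms(1) B(1) cinner_commute[of x b] by (auto simp: u_def cinner_simps)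
    have "u \<in> carrier H" using xc by (simp add: u_def)
    then have "orthonormal (insert u B)"
      using B(2) uu ub unfolding orthonormal_def by auto
    then have "u \<in> B" using max[of "insert u B"] x assms(2) B(1) by (auto simp: u_def)
    then show False using ub uu by force
  qed
  then have "orthonormal_basis H S B"
    using B by (simp add: orthonormal_basis_def orthonormal_def)
  then have "orthonormal_basis H S (SOME B. orthonormal_basis H S B)"
    by (rule someI)
  then show ?thesis using that by (simp add: hilbert_dim_def)
qed

lemma orthonormal_basisD:
  assumes "orthonormal_basis H S B" "S \<subseteq> carrier H"
  shows "B \<subseteq> S" "orthonormal B" "x \<in> S \<Longrightarrow> (\<And>b. b \<in> B \<Longrightarrow> cinner H x b = 0) \<Longrightarrow> x = \<zero>"
  using assms by (auto simp: orthonormal_basis_def orthonormal_def)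

lemma cinfinite_card_of: "cinfinite |B| \<longleftrightarrow> infinite B"
  by (simp add: cinfinite_def Field_card_of)

lemma finite_basis_hnorm_le:
  assumes B: "orthonormal_basis H S B" "finite B" and S: "linear_subspace H S" and x: "x \<in> S"
  shows "hnorm H x \<le> (\<Sum>b\<in>B. cmod (cinner H x b))"
proof -
  note SD = linear_subspaceD[OF S] and BD = orthonormal_basisD[OF B(1) linear_subspaceD(1)[OF S]]
  have BC: "b \<in> carrier H" if "b \<in> B" for b using BD(2) that by (auto simp: orthonormal_def)
  have xc: "x \<in> carrier H" using x SD(1) by blast
  define s where "s = (\<Oplus>b\<in>B. cinner H x b \<odot> b)"
  have sS: "s \<in> S"
    unfolding s_def by (rule finsum_in_subspace[OF S B(2)]) (use BD(1) SD in blast)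
  have sc: "s \<in> carrier H" using sS SD(1) by blast
  have "cinner H (x \<ominus> s) b = 0" if b: "b \<in> B" for b
  proof -
    have "cinner H s b = (\<Sum>i\<in>B. cinner H (cinner H x i \<odot> i) b)"
      unfolding s_def using BC b B(2) by (intro cinner_finsum_left) auto
    also have "\<dots> = (\<Sum>i\<in>B. if i = b then cinner H x b else 0)"
      using BD(2) BC b by (intro sum.cong) (auto simp: orthonormal_def cinner_simps)
    also have "\<dots> = cinner H x b" using b B(2) by simp
    finally show ?thesis using xc sc BC[OF b] by (simp add: cinner_simps)
  qed
  then have "x \<ominus> s = \<zero>" using BD(3)[of "x \<ominus> s"] SD(5)[OF x sS] by blast
  then have "x = s" using xc sc by (simp add: minus_eq_zero_iff)
  also have "hnorm H s \<le> (\<Sum>b\<in>B. hnorm H (cinner H x b \<odot> b))"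
    unfolding s_def using BC B(2) by (intro hnorm_finsum_le) auto
  also have "\<dots> = (\<Sum>b\<in>B. cmod (cinner H x b))"
  proof (rule sum.cong)
    fix b assume b: "b \<in> B"
    have "hnorm H b = 1" using BD(2) b by (auto simp: orthonormal_def hnorm_def)
    then show "hnorm H (cinner H x b \<odot> b) = cmod (cinner H x b)"
      using BC[OF b] by (simp add: hnorm_smult)
  qed simp
  finally show ?thesis by simp
qed

text \<open>
  Bolzano-Weierstrass for the coordinates with respect to a finite basis.
\<close>

lemma finite_dim_cauchy_subseq:
  assumes S: "linear_subspace H S" and fin: "\<not> cinfinite (hilbert_dim H S)"
    and x: "hbounded H x" "\<And>m. x m \<in> S"
  obtains r :: "nat \<Rightarrow> nat" where "strict_mono r" "hcauchy H (x \<circ> r)"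
proof -
  note SD = linear_subspaceD[OF S]
  obtain B where B: "orthonormal_basis H S B" "hilbert_dim H S = |B|"
    using hilbert_dim_basis[of S] SD by blast
  then have "finite B" using fin by (simp add: cinfinite_card_of)
  have BC: "b \<in> carrier H" if "b \<in> B" for b
    using orthonormal_basisD(1)[OF B(1) SD(1)] SD(1) that by blast
  note xc = hboundedD[OF x(1)]
  obtain C where C: "\<And>m. hnorm H (x m) \<le> C" using x(1) by (auto simp: hbounded_def)
  have bounded_coeff: "bounded (range (\<lambda>m. cinner H (x m) b))" if "b \<in> B" for b
  proof (rule boundedI)
    fix z assume "z \<in> range (\<lambda>m. cinner H (x m) b)"
    then obtain m where "z = cinner H (x m) b" by auto
    then show "norm z \<le> C * hnorm H b"
      using Cauchy_Schwarz[OF xc BC[OF that]] mult_right_mono[OF C hnorm_nonneg[OF BC[OF that]]]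
      by (meson order_trans)
  qed
  have "\<exists>r. strict_mono r \<and> (\<forall>b\<in>B. convergent ((\<lambda>m. cinner H (x m) b) \<circ> r))"
  proof (rule common_subsequence[OF \<open>finite B\<close>])
    fix b and r :: "nat \<Rightarrow> nat" assume "b \<in> B"
    have "bounded (range ((\<lambda>m. cinner H (x m) b) \<circ> r))"
      by (rule bounded_subset[OF bounded_coeff[OF \<open>b \<in> B\<close>]]) auto
    then show "\<exists>r'. strict_mono r' \<and> convergent ((\<lambda>m. cinner H (x m) b) \<circ> (r \<circ> r'))"
      using bounded_imp_convergent_subsequence by (metis convergent_def o_assoc)
  next
    show "convergent ((\<lambda>m. cinner H (x m) b) \<circ> (r \<circ> r'))"
      if "convergent ((\<lambda>m. cinner H (x m) b) \<circ> r)" "strict_mono r'" for b and r r' :: "nat \<Rightarrow> nat"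
      using convergent_subseq_convergent[OF that] by (simp add: o_assoc)
  qed
  then obtain r where r: "strict_mono r" "\<forall>b\<in>B. convergent ((\<lambda>m. cinner H (x m) b) \<circ> r)" by blast
  have "hcauchy H (x \<circ> r)"
  proof (rule hcauchy_if_sum_dominated[OF \<open>finite B\<close>])
    show "\<exists>N. \<forall>m\<ge>N. \<forall>k\<ge>N. cmod (cinner H (x (r m)) b - cinner H (x (r k)) b) < e"
      if "b \<in> B" "e > 0" for b and e :: real
      using r(2) that convergent_Cauchy[of "(\<lambda>m. cinner H (x m) b) \<circ> r"]
      unfolding Cauchy_def dist_norm o_def by blast
    fix m k
    have "hnorm H (x (r m) \<ominus> x (r k)) \<le> (\<Sum>b\<in>B. cmod (cinner H (x (r m) \<ominus> x (r k)) b))"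
      by (intro finite_basis_hnorm_le[OF B(1) \<open>finite B\<close> S] SD(5) x(2))
    then show "hnorm H ((x \<circ> r) m \<ominus> (x \<circ> r) k)
        \<le> (\<Sum>b\<in>B. cmod (cinner H (x (r m)) b - cinner H (x (r k)) b))"
      using BC xc by (simp add: cinner_minus_left)
  qed (use xc in auto)
  with r(1) show ?thesis by (rule that)
qed

text \<open>
  Distinct members of an orthonormal sequence have distance \<open>\<surd>2\<close>.
\<close>

lemma infinite_dim_sequence:
  assumes S: "linear_subspace H S" and inf: "cinfinite (hilbert_dim H S)"
  obtains x where "hbounded H x" "\<And>m. x m \<in> S" "\<And>r::nat \<Rightarrow> nat. strict_mono r \<Longrightarrow> \<not> hcauchy H (x \<circ> r)"
proof -
  note SD = linear_subspaceD[OF S]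
  obtain B where B: "orthonormal_basis H S B" "hilbert_dim H S = |B|"
    using hilbert_dim_basis[of S] SD by blast
  then have "infinite B" using inf by (simp add: cinfinite_card_of)
  then obtain x :: "nat \<Rightarrow> 'a" where x: "inj x" "range x \<subseteq> B"
    using infinite_countable_subset by blast
  note BD = orthonormal_basisD[OF B(1) SD(1)]
  have xB: "x m \<in> B" for m using x(2) by blast
  have xc: "x m \<in> carrier H" for m using xB BD(2) by (auto simp: orthonormal_def)
  have on: "cinner H (x m) (x k) = (if m = k then 1 else 0)" for m k
    using BD(2) xB x(1) by (auto simp: orthonormal_def inj_def)
  have n1: "hnorm H (x m) = 1" for m by (simp add: hnorm_def on)
  then have "hbounded H x" using xc unfolding hbounded_def by auto
  moreover have "x m \<in> S" for m using xB BD(1) by blast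
  moreover have "\<not> hcauchy H (x \<circ> r)" if "strict_mono r" for r :: "nat \<Rightarrow> nat"
  proof
    assume "hcauchy H (x \<circ> r)"
    then obtain N where "hnorm H (x (r N) \<ominus> x (r (Suc N))) < 1"
      unfolding hcauchy_def o_def by (metis le_SucI order_refl zero_less_one)
    then have "(hnorm H (x (r N) \<ominus> x (r (Suc N))))\<^sup>2 < 1"
      using xc by (simp add: power_less_one_iff)
    moreover have "r N \<noteq> r (Suc N)" using that by (auto simp: strict_mono_eq)
    ultimately show False by (simp add: hnorm_minus_square xc n1 on)
  qed
  ultimately show ?thesis by (rule that)
qed

end

section \<open>Bounded operators with closed range\<close>

context complex_hilbert_space
begin

text \<open>
  The sets of all \<open>y\<close> on which the functionals are bounded by \<open>m\<close> are closed and exhaust the space, so by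
  Baire's theorem one of them contains a ball.
\<close>

lemma uniform_boundedness:
  assumes W: "W \<subseteq> carrier H"
    and pointwise: "\<And>y. y \<in> carrier H \<Longrightarrow> \<exists>C. \<forall>w\<in>W. cmod (cinner H y w) \<le> C"
  obtains C where "\<And>w. w \<in> W \<Longrightarrow> hnorm H w \<le> C"
proof -
  define E where "E m = {y \<in> carrier H. \<forall>w\<in>W. cmod (cinner H y w) \<le> real m}" for m
  have closed: "closedin metric.mtopology (E m)" for m
    unfolding closed_in_def[symmetric] closed_in_iff_sequential
  proof (intro conjI allI impI)
    fix y l assume y: "\<forall>k. y k \<in> E m" and l: "hconv H y l"
    have "cmod (cinner H l w) \<le> real m" if w: "w \<in> W" for w
    proof (rule LIMSEQ_le_const2)
      show "(\<lambda>k. cmod (cinner H (y k) w)) \<longlonglongrightarrow> cmod (cinner H l w)"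
        using hconv_cinner[OF l, of w] w W by (intro tendsto_norm) auto
      show "\<exists>N. \<forall>n\<ge>N. cmod (cinner H (y n) w) \<le> real m"
        using y w by (auto simp: E_def)
    qed
    then show "l \<in> E m" using hconvD(2)[OF l] by (simp add: E_def)
  qed (auto simp: E_def)
  have "\<Union>(range E) = carrier H"
  proof
    show "carrier H \<subseteq> \<Union>(range E)"
    proof
      fix y assume y: "y \<in> carrier H"
      then obtain C where "\<forall>w\<in>W. cmod (cinner H y w) \<le> C" using pointwise by blast
      then have "y \<in> E (nat \<lceil>C\<rceil>)" using y unfolding E_def
        by (smt (verit) mem_Collect_eq of_nat_ceiling)
      then show "y \<in> \<Union>(range E)" by blast
    qed
  qed (auto simp: E_def)
  moreover have "metric.mtopology interior_of (carrier H) = carrier H"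
    by (metis interior_of_topspace metric.topspace_mtopology)
  moreover have "carrier H \<noteq> {}" by blast
  ultimately have "\<exists>m. metric.mtopology interior_of (E m) \<noteq> {}"
    using metric.metric_Baire_category_alt[OF complete, of "range E"] closed by (metis (mono_tags) countable_image countableI_type imageE)
  then obtain m where "metric.mtopology interior_of (E m) \<noteq> {}" by blast
  then obtain y where "y \<in> metric.mtopology interior_of (E m)" by blast
  moreover have "openin metric.mtopology (metric.mtopology interior_of (E m))" by simp
  ultimately obtain r where r: "r > 0" "metric.mball y r \<subseteq> metric.mtopology interior_of (E m)"
    unfolding metric.openin_mtopology by blast
  then have ball: "metric.mball y r \<subseteq> E m" using interior_of_subset by (metis order_trans)
  have yE: "y \<in> E m"
    using \<open>y \<in> metric.mtopology interior_of (E m)\<close> interior_of_subset by (rule rev_subsetD)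
  then have yc: "y \<in> carrier H" by (simp add: E_def)
  have "hnorm H w \<le> 4 * real m / r" if w: "w \<in> W" for w
  proof (cases "w = \<zero>")
    case False
    have wc: "w \<in> carrier H" using w W by blast
    have n: "hnorm H w > 0" using hnorm_pos[OF wc False] .
    \<comment> \<open>The point at distance \<open>r / 2\<close> from \<open>y\<close> in the direction of \<open>w\<close>.\<close>
    define u where "u = of_real (r / 2 / hnorm H w) \<odot> w"
    have uc: "u \<in> carrier H" using wc by (simp add: u_def)
    have "y \<ominus> (y \<oplus> u) = (-1) \<odot> u"
      by (rule cinner_ext) (use yc uc in \<open>simp_all add: cinner_simps\<close>)
    then have "hnorm H (y \<ominus> (y \<oplus> u)) = r / 2"
      using n r(1) uc wc by (simp add: u_def hnorm_smult norm_mult norm_divide)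
    then have "y \<oplus> u \<in> metric.mball y r"
      using r(1) yc uc by (simp add: metric.in_mball hdist_def)
    then have "cmod (cinner H (y \<oplus> u) w) \<le> m" "cmod (cinner H y w) \<le> m"
      using ball yE w by (auto simp: E_def)
    moreover have "cinner H u w = cinner H (y \<oplus> u) w - cinner H y w"
      using yc uc wc by (simp add: cinner_simps)
    ultimately have "cmod (cinner H u w) \<le> 2 * m"
      using norm_triangle_ineq4[of "cinner H (y \<oplus> u) w" "cinner H y w"] by simp
    moreover have "cinner H u w = of_real (r / 2 * hnorm H w)"
      using n wc by (simp add: u_def cinner_smult_left cinner_self power2_eq_square)
    then have "cmod (cinner H u w) = r / 2 * hnorm H w"
      using r(1) n by (simp only: norm_of_real) simp
    ultimately show ?thesis using r(1) by (simp add: field_simps)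
  qed (use r(1) in simp)
  then show ?thesis by (rule that)
qed

lemma orthogonal_split:
  assumes S: "linear_subspace H S" "closed_in H S" and x: "x \<in> carrier H"
  obtains p where "p \<in> S" "x \<ominus> p \<in> orth_complement H S"
    "hnorm H p \<le> hnorm H x" "hnorm H (x \<ominus> p) \<le> hnorm H x"
proof -
  obtain p where p: "p \<in> S" "\<And>s. s \<in> S \<Longrightarrow> cinner H (x \<ominus> p) s = 0"
    using projection_exists[OF assms] by blast
  have pc: "p \<in> carrier H" using p(1) linear_subspaceD(1)[OF S(1)] by blast
  have "x \<ominus> p \<in> orth_complement H S" using p x pc by (simp add: orth_complement_def)
  moreover have "(hnorm H x)\<^sup>2 = (hnorm H (x \<ominus> p))\<^sup>2 + (hnorm H p)\<^sup>2"
    using hnorm_add_square[of "x \<ominus> p" p] p x pc by (simp add: minus_add_cancel)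
  then have "(hnorm H p)\<^sup>2 \<le> (hnorm H x)\<^sup>2" "(hnorm H (x \<ominus> p))\<^sup>2 \<le> (hnorm H x)\<^sup>2" by simp_all
  then have "hnorm H p \<le> hnorm H x" "hnorm H (x \<ominus> p) \<le> hnorm H x"
    using power2_le_imp_le hnorm_nonneg[OF x] by blast+
  ultimately show ?thesis using that p(1) by blast
qed

end

locale bounded_operator = H: complex_hilbert_space H + K: complex_hilbert_space K
  for H :: "'a ip_space" and K :: "'b ip_space" +
  fixes T :: "'a \<Rightarrow> 'b"
  assumes bounded_op: "T \<in> bounded_ops H K"
begin

lemma op_closed [simp]: "x \<in> carrier H \<Longrightarrow> T x \<in> carrier K"
  using bounded_op by (auto simp: bounded_ops_def)

lemma op_add: "\<lbrakk>x \<in> carrier H; y \<in> carrier H\<rbrakk> \<Longrightarrow> T (x \<oplus>\<^bsub>H\<^esub> y) = T x \<oplus>\<^bsub>K\<^esub> T y"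
  using bounded_op by (auto simp: bounded_ops_def)

lemma op_smult: "x \<in> carrier H \<Longrightarrow> T (c \<odot>\<^bsub>H\<^esub> x) = c \<odot>\<^bsub>K\<^esub> T x"
  using bounded_op by (auto simp: bounded_ops_def)

lemma op_minus: "\<lbrakk>x \<in> carrier H; y \<in> carrier H\<rbrakk> \<Longrightarrow> T (x \<ominus>\<^bsub>H\<^esub> y) = T x \<ominus>\<^bsub>K\<^esub> T y"
  by (simp add: H.minus_eq_smult K.minus_eq_smult op_add op_smult)

lemma op_zero [simp]: "T \<zero>\<^bsub>H\<^esub> = \<zero>\<^bsub>K\<^esub>"
proof -
  have "T (\<zero>\<^bsub>H\<^esub> \<ominus>\<^bsub>H\<^esub> \<zero>\<^bsub>H\<^esub>) = T \<zero>\<^bsub>H\<^esub> \<ominus>\<^bsub>K\<^esub> T \<zero>\<^bsub>H\<^esub>"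
    by (rule op_minus) auto
  then show ?thesis by simp
qed

lemma op_bound:
  obtains C where "C > 0" "\<And>x. x \<in> carrier H \<Longrightarrow> hnorm K (T x) \<le> C * hnorm H x"
proof -
  obtain C where C: "\<And>x. x \<in> carrier H \<Longrightarrow> hnorm K (T x) \<le> C * hnorm H x"
    using bounded_op unfolding bounded_ops_def by blast
  have "hnorm K (T x) \<le> max C 1 * hnorm H x" if "x \<in> carrier H" for x
    using C[OF that] mult_right_mono[of C "max C 1" "hnorm H x"] that by simp
  then show ?thesis using that[of "max C 1"] by simp
qed

lemma op_hcauchy: "hcauchy H x \<Longrightarrow> hcauchy K (\<lambda>m. T (x m))"
proof -
  assume x: "hcauchy H x"
  obtain C where "\<And>x. x \<in> carrier H \<Longrightarrow> hnorm K (T x) \<le> C * hnorm H x" using op_bound by blast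
  then have "hnorm K (T (x m) \<ominus>\<^bsub>K\<^esub> T (x k)) \<le> C * hnorm H (x m \<ominus>\<^bsub>H\<^esub> x k)" for m k
    using hcauchyD[OF x] by (metis op_minus H.minus_closed)
  then show ?thesis
    by (rule hcauchy_dominated[OF x op_closed[OF hcauchyD[OF x]] _ H.pre_hilbert_axioms])
qed

lemma op_hconv:
  assumes "hconv H x l" shows "hconv K (\<lambda>m. T (x m)) (T l)"
  unfolding hconv_def
proof (intro conjI allI)
  note xc = hconvD[OF assms]
  obtain C where C: "\<And>x. x \<in> carrier H \<Longrightarrow> hnorm K (T x) \<le> C * hnorm H x" using op_bound by blast
  show "(\<lambda>m. hnorm K (T (x m) \<ominus>\<^bsub>K\<^esub> T l)) \<longlonglongrightarrow> 0"
  proof (rule Lim_null_comparison)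
    show "\<forall>\<^sub>F m in sequentially. norm (hnorm K (T (x m) \<ominus>\<^bsub>K\<^esub> T l)) \<le> C * hnorm H (x m \<ominus>\<^bsub>H\<^esub> l)"
      using C xc by (simp flip: op_minus)
    show "(\<lambda>m. C * hnorm H (x m \<ominus>\<^bsub>H\<^esub> l)) \<longlonglongrightarrow> 0"
      using assms by (auto simp: hconv_def intro: tendsto_mult_right_zero)
  qed
qed (use hconvD[OF assms] in auto)

lemma op_hbounded:
  assumes "hbounded H x" shows "hbounded K (\<lambda>m. T (x m))"
proof -
  obtain C where C: "C > 0" "\<And>x. x \<in> carrier H \<Longrightarrow> hnorm K (T x) \<le> C * hnorm H x" using op_bound by blast
  obtain B where B: "\<And>m. hnorm H (x m) \<le> B" using assms by (auto simp: hbounded_def)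
  have "hnorm K (T (x m)) \<le> C * B" for m
    using C(2)[OF hboundedD[OF assms]] mult_left_mono[OF B, of C] C(1) by (meson less_imp_le order_trans)
  then show ?thesis using hboundedD[OF assms] unfolding hbounded_def by auto
qed

abbreviation "ker \<equiv> a_kernel H K T"
abbreviation "coker_space \<equiv> orth_complement K (T ` carrier H)"

lemma ker_iff: "x \<in> ker \<longleftrightarrow> x \<in> carrier H \<and> T x = \<zero>\<^bsub>K\<^esub>"
  by (simp add: a_kernel_def')

lemma ker_subspace: "linear_subspace H ker"
  by (auto simp: linear_subspace_def ker_iff op_add op_smult)

lemma ker_closed: "closed_in H ker"
  unfolding H.closed_in_iff_sequential
proof (intro conjI allI impI)
  fix x l assume x: "\<forall>m. x m \<in> ker" "hconv H x l"
  have "hconv K (\<lambda>m. T (x m)) (T l)" using op_hconv[OF x(2)] .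
  moreover have "T (x m) = \<zero>\<^bsub>K\<^esub>" for m using x(1) by (simp add: ker_iff)
  moreover have "hconv K (\<lambda>m. \<zero>\<^bsub>K\<^esub>) \<zero>\<^bsub>K\<^esub>" by (simp add: hconv_def)
  ultimately have "T l = \<zero>\<^bsub>K\<^esub>" using K.hconv_unique by simp
  then show "l \<in> ker" using hconvD(2)[OF x(2)] by (simp add: ker_iff)
qed (auto simp: ker_iff)

lemma image_subspace:
  assumes "linear_subspace H S" shows "linear_subspace K (T ` S)"
  unfolding linear_subspace_def
proof (intro conjI ballI allI)
  note SD = H.linear_subspaceD[OF assms]
  have SC: "x \<in> carrier H" if "x \<in> S" for x using SD(1) that by blast
  show "T ` S \<subseteq> carrier K" using SC by auto
  show "\<zero>\<^bsub>K\<^esub> \<in> T ` S" using SD(2) by (metis imageI op_zero)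
  fix x assume "x \<in> T ` S"
  then obtain a where a: "a \<in> S" "x = T a" by blast
  then show "c \<odot>\<^bsub>K\<^esub> x \<in> T ` S" for c
    using SD(4)[OF a(1), of c] SC by (auto simp flip: op_smult)
  fix y assume "y \<in> T ` S"
  then obtain b where b: "b \<in> S" "y = T b" by blast
  then show "x \<oplus>\<^bsub>K\<^esub> y \<in> T ` S"
    using SD(3)[OF a(1) b(1)] a SC by (auto simp flip: op_add)
qed

lemma range_subspace: "linear_subspace K (T ` carrier H)"
  by (intro image_subspace) simp

text \<open>
  The adjoint, by Riesz representation of the functionals \<open>x \<mapsto> \<langle>T x, y\<rangle>\<close>.
\<close>

lemma adjoint:
  obtains S where "S \<in> bounded_ops K H"
    "\<And>x y. \<lbrakk>x \<in> carrier H; y \<in> carrier K\<rbrakk> \<Longrightarrow> cinner K (T x) y = cinner H x (S y)"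
proof -
  obtain C where C: "C > 0" "\<And>x. x \<in> carrier H \<Longrightarrow> hnorm K (T x) \<le> C * hnorm H x" using op_bound by blast
  have CS: "cmod (cinner K (T x) y) \<le> C * hnorm K y * hnorm H x" if "x \<in> carrier H" "y \<in> carrier K" for x y
    using K.Cauchy_Schwarz[OF op_closed[OF that(1)] that(2)]
      mult_right_mono[OF C(2)[OF that(1)] K.hnorm_nonneg[OF that(2)]] by (simp add: mult_ac)
  have "\<exists>z. z \<in> carrier H \<and> (\<forall>x\<in>carrier H. cinner K (T x) y = cinner H x z)" if y: "y \<in> carrier K" for y
    by (rule H.Riesz[of "\<lambda>x. cinner K (T x) y" "C * hnorm K y"])
      (use y CS in \<open>auto simp: op_add op_smult K.cinner_simps\<close>)
  then obtain S where S: "\<And>y. y \<in> carrier K \<Longrightarrow> S y \<in> carrier H"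
    "\<And>x y. \<lbrakk>x \<in> carrier H; y \<in> carrier K\<rbrakk> \<Longrightarrow> cinner K (T x) y = cinner H x (S y)"
    by metis
  have S': "cinner H (S y) x = cinner K y (T x)" if "x \<in> carrier H" "y \<in> carrier K" for x y
    using S(2)[OF that] H.cinner_commute[of x "S y"] K.cinner_commute[of "T x" y] that S(1) by simp
  have "S \<in> bounded_ops K H"
    unfolding bounded_ops_def
  proof (intro CollectI conjI ballI allI exI)
    show "S \<in> carrier K \<rightarrow> carrier H" using S(1) by blast
    show "S (x \<oplus>\<^bsub>K\<^esub> y) = S x \<oplus>\<^bsub>H\<^esub> S y" if "x \<in> carrier K" "y \<in> carrier K" for x y
      by (rule H.cinner_ext) (use that S(1) in \<open>simp_all add: S' H.cinner_simps K.cinner_simps\<close>)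
    show "S (c \<odot>\<^bsub>K\<^esub> x) = c \<odot>\<^bsub>H\<^esub> S x" if "x \<in> carrier K" for c x
      by (rule H.cinner_ext) (use that S(1) in \<open>simp_all add: S' H.cinner_simps K.cinner_simps\<close>)
    show "hnorm H (S y) \<le> C * hnorm K y" if y: "y \<in> carrier K" for y
    proof (cases "hnorm H (S y) = 0")
      case False
      then have n: "hnorm H (S y) > 0" using H.hnorm_nonneg[OF S(1)[OF y]] by simp
      have "cinner K (T (S y)) y = of_real ((hnorm H (S y))\<^sup>2)"
        using S(2)[OF S(1)[OF y] y] H.cinner_self[OF S(1)[OF y]] by simp
      then have "(hnorm H (S y))\<^sup>2 \<le> C * hnorm K y * hnorm H (S y)"
        using CS[OF S(1)[OF y] y] by (simp del: of_real_power)
      then show ?thesis using n by (simp add: power2_eq_square)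
    qed (use y C(1) in simp)
  qed
  then show ?thesis using S(2) that by blast
qed

lemma bounded_below_image_closed:
  assumes S: "linear_subspace H S" "closed_in H S"
    and below: "\<And>x. x \<in> S \<Longrightarrow> hnorm H x \<le> C * hnorm K (T x)"
  shows "closed_in K (T ` S)"
  unfolding K.closed_in_iff_sequential
proof (intro conjI allI impI)
  note SD = H.linear_subspaceD[OF S(1)]
  have SC: "x \<in> carrier H" if "x \<in> S" for x using SD(1) that by blast
  show "T ` S \<subseteq> carrier K" using SC by auto
  fix y l assume "\<forall>m. y m \<in> T ` S" and l: "hconv K y l"
  then have "\<forall>m. \<exists>x. x \<in> S \<and> y m = T x" by blast
  then obtain x where x: "\<And>m. x m \<in> S" "\<And>m. y m = T (x m)" by metis
  have "hcauchy H x"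
  proof (rule hcauchy_dominated[OF K.hconv_imp_hcauchy[OF l]])
    show "hnorm H (x m \<ominus>\<^bsub>H\<^esub> x k) \<le> C * hnorm K (y m \<ominus>\<^bsub>K\<^esub> y k)" for m k
      using below[OF SD(5)[OF x(1) x(1)]] SC[OF x(1)] by (simp add: x(2) op_minus)
    show "pre_hilbert K" by (rule K.pre_hilbert_axioms)
  qed (use x(1) SC in auto)
  then obtain l' where l': "hconv H x l'" using H.hcauchy_imp_hconv by blast
  have "l' \<in> S" by (rule H.closed_in_limit[OF S(2) l' x(1)])
  moreover have "hconv K y (T l')" using op_hconv[OF l'] by (simp flip: x(2))
  then have "l = T l'" using K.hconv_unique[OF l] by simp
  ultimately show "l \<in> T ` S" by blast
qed

text \<open>
  The bounded inverse theorem, obtained by duality.  Uniform boundedness of the vectors \<open>w\<close> in the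
  range with \<open>\<parallel>S w\<parallel> \<le> 1\<close>, where \<open>S\<close> is the adjoint, makes \<open>S\<close> bounded below on the range; hence \<open>S\<close> maps the
  range onto \<open>ker\<^sup>\<bottom>\<close>, and an estimate for \<open>S\<close> turns into one for \<open>T\<close>.
\<close>

lemma closed_range_bounded_below:
  assumes closed: "closed_in K (T ` carrier H)"
  obtains C where "C > 0" "\<And>x. x \<in> orth_complement H ker \<Longrightarrow> hnorm H x \<le> C * hnorm K (T x)"
proof -
  obtain S where S: "S \<in> bounded_ops K H"
    "\<And>x y. \<lbrakk>x \<in> carrier H; y \<in> carrier K\<rbrakk> \<Longrightarrow> cinner K (T x) y = cinner H x (S y)"
    using adjoint by blast
  interpret S: bounded_operator K H S by unfold_locales (rule S(1))
  define R where "R = T ` carrier H"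
  have R: "linear_subspace K R" "closed_in K R" "R \<subseteq> carrier K"
    using range_subspace closed by (auto simp: R_def)
  define W where "W = {w \<in> R. hnorm H (S w) \<le> 1}"
  have "\<exists>C. \<forall>w\<in>W. cmod (cinner K y w) \<le> C" if y: "y \<in> carrier K" for y
  proof -
    obtain p where p: "p \<in> R" "\<And>w. w \<in> R \<Longrightarrow> cinner K (y \<ominus>\<^bsub>K\<^esub> p) w = 0"
      using K.projection_exists[OF R(1,2) y] by blast
    then obtain x where x: "x \<in> carrier H" "p = T x" by (auto simp: R_def)
    have "cmod (cinner K y w) \<le> hnorm H x" if w: "w \<in> W" for w
    proof -
      have wR: "w \<in> R" "w \<in> carrier K" "hnorm H (S w) \<le> 1" using w R(3) by (auto simp: W_def)
      have "cinner K y w = cinner K (T x) w"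
        using p(2)[OF wR(1)] y x wR by (simp add: K.cinner_minus_left)
      also have "\<dots> = cinner H x (S w)" using S(2) x wR by simp
      finally have "cmod (cinner K y w) \<le> hnorm H x * hnorm H (S w)"
        using H.Cauchy_Schwarz[OF x(1), of "S w"] wR by simp
      also have "\<dots> \<le> hnorm H x" using wR x by (simp add: mult_left_le)
      finally show ?thesis .
    qed
    then show ?thesis by blast
  qed
  then obtain C0 where C0: "\<And>w. w \<in> W \<Longrightarrow> hnorm K w \<le> C0"
    using K.uniform_boundedness[of W] R(3) W_def by blast
  define C where "C = max C0 1"
  have C: "C > 0" "\<And>w. w \<in> W \<Longrightarrow> hnorm K w \<le> C" using C0 by (force simp: C_def)+
  have below: "hnorm K w \<le> C * hnorm H (S w)" if w: "w \<in> R" for w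
  proof -
    have wc: "w \<in> carrier K" using w R(3) by blast
    show ?thesis
    proof (cases "S w = \<zero>\<^bsub>H\<^esub>")
      case True
      obtain x where x: "x \<in> carrier H" "w = T x" using w by (auto simp: R_def)
      have "cinner K w w = 0" using S(2)[OF x(1) wc] True x by simp
      then show ?thesis using True by (simp add: hnorm_def)
    next
      case False
      define a where "a = hnorm H (S w)"
      have a: "a > 0" using H.hnorm_pos[OF _ False] wc by (simp add: a_def)
      have "of_real (1 / a) \<odot>\<^bsub>K\<^esub> w \<in> W"
        using a wc K.linear_subspaceD(4)[OF R(1) w]
        by (simp add: W_def S.op_smult H.hnorm_smult norm_divide a_def[symmetric])
      then have "hnorm K (of_real (1 / a) \<odot>\<^bsub>K\<^esub> w) \<le> C" by (rule C(2))
      then show ?thesis using a wc by (simp add: K.hnorm_smult norm_divide field_simps flip: a_def)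
    qed
  qed
  have SR: "linear_subspace H (S ` R)" "closed_in H (S ` R)"
    using S.image_subspace[OF R(1)] S.bounded_below_image_closed[OF R(1,2) below] by auto
  have "hnorm H x \<le> C * hnorm K (T x)" if x: "x \<in> orth_complement H ker" for x
  proof (cases "hnorm H x = 0")
    case False
    have xc: "x \<in> carrier H" using x by (simp add: orth_complement_def)
    have "x \<in> S ` R"
    proof (rule H.orth_complement_twice[OF SR xc])
      fix y assume y: "y \<in> orth_complement H (S ` R)"
      then have yc: "y \<in> carrier H" by (simp add: orth_complement_def)
      have TR: "T y \<in> R" using yc by (simp add: R_def)
      have "cinner K (T y) (T y) = cinner H y (S (T y))" using S(2) yc by simp
      also have "\<dots> = 0" using y TR by (simp add: orth_complement_def)
      finally have "T y = \<zero>\<^bsub>K\<^esub>" using K.cinner_pos[of "T y"] yc by force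
      then show "cinner H x y = 0" using x yc by (simp add: orth_complement_def ker_iff)
    qed
    then obtain w where w: "w \<in> R" "x = S w" by blast
    have wc: "w \<in> carrier K" using w R(3) by blast
    have "of_real ((hnorm H x)\<^sup>2) = cinner K (T x) w"
      using H.cinner_self[OF xc] S(2)[OF xc wc] w(2) by simp
    then have "(hnorm H x)\<^sup>2 \<le> hnorm K (T x) * hnorm K w"
      using K.Cauchy_Schwarz[of "T x" w] xc wc by (metis norm_of_real abs_of_nonneg op_closed zero_le_power2)
    also have "\<dots> \<le> hnorm K (T x) * (C * hnorm H x)"
      using below[OF w(1)] w(2) xc by (intro mult_left_mono) auto
    finally have "hnorm H x * hnorm H x \<le> (C * hnorm K (T x)) * hnorm H x"
      by (simp add: power2_eq_square mult_ac)
    then show ?thesis using False xc H.hnorm_nonneg[OF xc] by simp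
  next
    case True
    then show ?thesis using C(1) x by (simp add: orth_complement_def)
  qed
  with C(1) show ?thesis by (rule that)
qed

lemma range_eq_image_ker_complement: "T ` carrier H = T ` orth_complement H ker"
proof
  show "T ` carrier H \<subseteq> T ` orth_complement H ker"
  proof
    fix y assume "y \<in> T ` carrier H"
    then obtain x where x: "x \<in> carrier H" "y = T x" by blast
    obtain p where p: "p \<in> ker" "x \<ominus>\<^bsub>H\<^esub> p \<in> orth_complement H ker"
      using H.orthogonal_split[OF ker_subspace ker_closed x(1)] by blast
    have "T (x \<ominus>\<^bsub>H\<^esub> p) = y"
      using p(1) x by (simp add: ker_iff op_minus)
    then show "y \<in> T ` orth_complement H ker" using p(2) by blast
  qed
qed (auto simp: orth_complement_def)

end

section \<open>Upper semi-Fredholm operators in terms of sequences\<close>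

text \<open>
  Unlike the two conditions on kernel and range, this property can be verified for a block operator one
  component at a time, by passing to subsequences.
\<close>

definition cauchy_reflecting :: "'a ip_space \<Rightarrow> 'b ip_space \<Rightarrow> ('a \<Rightarrow> 'b) \<Rightarrow> bool" where
  "cauchy_reflecting H K T \<longleftrightarrow> (\<forall>x. hbounded H x \<longrightarrow> hcauchy K (\<lambda>m. T (x m))
    \<longrightarrow> (\<exists>r::nat \<Rightarrow> nat. strict_mono r \<and> hcauchy H (x \<circ> r)))"

context bounded_operator
begin

text \<open>
  The components orthogonal to the kernel have the same image, and \<open>T\<close> is bounded below on them.
\<close>

lemma closed_range_split_sequence:
  assumes closed: "closed_in K (T ` carrier H)"
    and x: "hbounded H x" and Tx: "hcauchy K (\<lambda>m. T (x m))"
  obtains p where "hbounded H p" "\<And>m. p m \<in> ker" "hcauchy H (\<lambda>m. x m \<ominus>\<^bsub>H\<^esub> p m)"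
proof -
  note xc = hboundedD[OF x]
  have "\<exists>p. p \<in> ker \<and> x m \<ominus>\<^bsub>H\<^esub> p \<in> orth_complement H ker \<and> hnorm H p \<le> hnorm H (x m)" for m
    using H.orthogonal_split[OF ker_subspace ker_closed xc[of m]] by metis
  then obtain p where p: "\<And>m. p m \<in> ker" "\<And>m. x m \<ominus>\<^bsub>H\<^esub> p m \<in> orth_complement H ker"
    "\<And>m. hnorm H (p m) \<le> hnorm H (x m)" by metis
  have pc: "p m \<in> carrier H" "T (p m) = \<zero>\<^bsub>K\<^esub>" for m using p(1) by (auto simp: ker_iff)
  have "hbounded H p"
    using x p(3) pc unfolding hbounded_def by (meson order_trans)
  moreover have "hcauchy H (\<lambda>m. x m \<ominus>\<^bsub>H\<^esub> p m)"
  proof -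
    obtain C where C: "C > 0" "\<And>x. x \<in> orth_complement H ker \<Longrightarrow> hnorm H x \<le> C * hnorm K (T x)"
      using closed_range_bounded_below[OF closed] by blast
    have "ker \<subseteq> carrier H" by (auto simp: ker_iff)
    note orth = H.linear_subspaceD(5)[OF H.orth_complement_subspace[OF this]]
    show ?thesis
    proof (rule hcauchy_dominated[OF Tx])
      fix m k
      show "hnorm H ((x m \<ominus>\<^bsub>H\<^esub> p m) \<ominus>\<^bsub>H\<^esub> (x k \<ominus>\<^bsub>H\<^esub> p k)) \<le> C * hnorm K (T (x m) \<ominus>\<^bsub>K\<^esub> T (x k))"
        using C(2)[OF orth[OF p(2) p(2)], of m k] xc pc by (simp add: op_minus)
    qed (use xc pc in \<open>auto intro: K.pre_hilbert_axioms\<close>)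
  qed
  ultimately show ?thesis using that p(1) by blast
qed

lemma cauchy_reflecting_if_closed_range_finite_ker:
  assumes closed: "closed_in K (T ` carrier H)" and fin: "\<not> cinfinite (hilbert_dim H ker)"
  shows "cauchy_reflecting H K T"
  unfolding cauchy_reflecting_def
proof (intro allI impI)
  fix x assume x: "hbounded H x" "hcauchy K (\<lambda>m. T (x m))"
  obtain p where p: "hbounded H p" "\<And>m. p m \<in> ker" "hcauchy H (\<lambda>m. x m \<ominus>\<^bsub>H\<^esub> p m)"
    using closed_range_split_sequence[OF closed x] by blast
  obtain r :: "nat \<Rightarrow> nat" where r: "strict_mono r" "hcauchy H (p \<circ> r)"
    using H.finite_dim_cauchy_subseq[OF ker_subspace fin p(1,2)] by blast
  have "hcauchy H (\<lambda>m. (x (r m) \<ominus>\<^bsub>H\<^esub> p (r m)) \<oplus>\<^bsub>H\<^esub> p (r m))"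
    using H.hcauchy_add[OF hcauchy_subseq[OF p(3) r(1)] r(2)] by (simp add: o_def)
  then have "hcauchy H (x \<circ> r)"
    using hboundedD[OF x(1)] hboundedD[OF p(1)] by (simp add: o_def H.minus_add_cancel)
  with r(1) show "\<exists>r::nat \<Rightarrow> nat. strict_mono r \<and> hcauchy H (x \<circ> r)" by blast
qed

lemma finite_ker_if_cauchy_reflecting:
  assumes "cauchy_reflecting H K T" shows "\<not> cinfinite (hilbert_dim H ker)"
proof
  assume "cinfinite (hilbert_dim H ker)"
  then obtain x where x: "hbounded H x" "\<And>m. x m \<in> ker"
      "\<And>r::nat \<Rightarrow> nat. strict_mono r \<Longrightarrow> \<not> hcauchy H (x \<circ> r)"
    using H.infinite_dim_sequence[OF ker_subspace] by blast
  have "hcauchy K (\<lambda>m. T (x m))" using x(2) by (simp add: ker_iff)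
  then show False using assms x(1,3) unfolding cauchy_reflecting_def by blast
qed

text \<open>
  Otherwise there are unit vectors orthogonal to the kernel with images tending to \<open>0\<close>; the limit of a Cauchy
  subsequence would be a unit vector both in the kernel and orthogonal to it.
\<close>

lemma closed_range_if_cauchy_reflecting:
  assumes "cauchy_reflecting H K T" shows "closed_in K (T ` carrier H)"
proof -
  define N where "N = orth_complement H ker"
  have ks: "ker \<subseteq> carrier H" by (auto simp: ker_iff)
  have N: "linear_subspace H N" "closed_in H N" "N \<subseteq> carrier H"
    using H.orth_complement_subspace[OF ks] H.orth_complement_closed[OF ks]
    by (auto simp: N_def orth_complement_def)
  have "\<exists>C. \<forall>x\<in>N. hnorm H x \<le> C * hnorm K (T x)"
  proof (rule ccontr)
    assume "\<not> ?thesis"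
    then have "\<forall>m::nat. \<exists>x. x \<in> N \<and> hnorm H x > real (Suc m) * hnorm K (T x)"
      by (meson not_le)
    then obtain z where z: "\<And>m. z m \<in> N" "\<And>m. hnorm H (z m) > real (Suc m) * hnorm K (T (z m))"
      by metis
    have zc: "z m \<in> carrier H" for m using z(1) N(3) by blast
    have zpos: "hnorm H (z m) > 0" for m
      by (rule le_less_trans[OF _ z(2)]) (simp add: zc)
    define x where "x m = of_real (1 / hnorm H (z m)) \<odot>\<^bsub>H\<^esub> z m" for m
    have xN: "x m \<in> N" for m unfolding x_def by (intro H.linear_subspaceD(4)[OF N(1)] z(1))
    have xc: "x m \<in> carrier H" for m using xN N(3) by blast
    have n1: "hnorm H (x m) = 1" for m
      using zpos[of m] zc[of m] by (simp add: x_def H.hnorm_smult norm_divide)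
    have Tx: "hnorm K (T (x m)) \<le> inverse (real (Suc m))" for m
    proof -
      have "hnorm K (T (x m)) = hnorm K (T (z m)) / hnorm H (z m)"
        using zpos[of m] zc[of m] by (simp add: x_def op_smult K.hnorm_smult norm_divide)
      also have "\<dots> \<le> inverse (real (Suc m))"
        using z(2)[of m] zpos[of m] by (simp add: field_simps)
      finally show ?thesis .
    qed
    have "hconv K (\<lambda>m. T (x m)) \<zero>\<^bsub>K\<^esub>"
      unfolding hconv_def
    proof (intro conjI allI)
      show "(\<lambda>m. hnorm K (T (x m) \<ominus>\<^bsub>K\<^esub> \<zero>\<^bsub>K\<^esub>)) \<longlonglongrightarrow> 0"
        by (rule Lim_null_comparison[OF _ LIMSEQ_inverse_real_of_nat]) (use Tx xc in simp)
    qed (use xc in auto)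
    note conv0 = this
    have "hbounded H x" using n1 xc unfolding hbounded_def by auto
    then obtain r :: "nat \<Rightarrow> nat" where r: "strict_mono r" "hcauchy H (x \<circ> r)"
      using assms K.hconv_imp_hcauchy[OF conv0] unfolding cauchy_reflecting_def by blast
    then obtain l where l: "hconv H (x \<circ> r) l" using H.hcauchy_imp_hconv by blast
    have "l \<in> N" by (rule H.closed_in_limit[OF N(2) l]) (simp add: xN)
    have "hconv K (\<lambda>m. T ((x \<circ> r) m)) \<zero>\<^bsub>K\<^esub>"
      using conv0 LIMSEQ_subseq_LIMSEQ[OF _ r(1)] by (auto simp: hconv_def o_def)
    then have "T l = \<zero>\<^bsub>K\<^esub>" using K.hconv_unique[OF op_hconv[OF l]] by simp
    then have "l \<in> ker" using hconvD(2)[OF l] by (simp add: ker_iff)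
    then have "cinner H l l = 0" using \<open>l \<in> N\<close> by (simp add: N_def orth_complement_def)
    then have "hnorm H l = 0" by (simp add: hnorm_def)
    moreover have "(\<lambda>m. hnorm H ((x \<circ> r) m)) \<longlonglongrightarrow> hnorm H l" by (rule H.hconv_hnorm[OF l])
    ultimately show False by (simp add: n1 LIMSEQ_const_iff)
  qed
  then obtain C where "\<And>x. x \<in> N \<Longrightarrow> hnorm H x \<le> C * hnorm K (T x)" by blast
  then have "closed_in K (T ` N)" by (rule bounded_below_image_closed[OF N(1,2)])
  then show ?thesis using range_eq_image_ker_complement by (simp add: N_def)
qed

text \<open>
  The components of \<open>w\<close> in the range have bounded preimages, by the bounded inverse theorem; those in the
  finite dimensional complement have a Cauchy subsequence.
\<close>

lemma bounded_correction:
  assumes closed: "closed_in K (T ` carrier H)" and fin: "\<not> cinfinite (hilbert_dim K coker_space)"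
    and w: "hbounded K w"
  obtains r :: "nat \<Rightarrow> nat" and y where "strict_mono r" "hbounded H y"
    "hcauchy K (\<lambda>m. w (r m) \<oplus>\<^bsub>K\<^esub> T (y m))"
proof -
  note wc = hboundedD[OF w]
  have Rc: "T ` carrier H \<subseteq> carrier K" by auto
  obtain B where B: "\<And>m. hnorm K (w m) \<le> B" using w by (auto simp: hbounded_def)
  obtain C where C: "C > 0" "\<And>x. x \<in> orth_complement H ker \<Longrightarrow> hnorm H x \<le> C * hnorm K (T x)"
    using closed_range_bounded_below[OF closed] by blast
  have "\<exists>v. v \<in> carrier H \<and> w m \<ominus>\<^bsub>K\<^esub> T v \<in> coker_space \<and> hnorm H v \<le> C * B
      \<and> hnorm K (w m \<ominus>\<^bsub>K\<^esub> T v) \<le> B" for m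
  proof -
    obtain p where p: "p \<in> T ` carrier H" "w m \<ominus>\<^bsub>K\<^esub> p \<in> coker_space"
      "hnorm K p \<le> hnorm K (w m)" "hnorm K (w m \<ominus>\<^bsub>K\<^esub> p) \<le> hnorm K (w m)"
      using K.orthogonal_split[OF range_subspace closed wc[of m]] by blast
    then obtain v where v: "v \<in> orth_complement H ker" "p = T v"
      unfolding range_eq_image_ker_complement by blast
    have "hnorm H v \<le> C * B"
      using C(2)[OF v(1)] p(3) B[of m] mult_left_mono[of "hnorm K p" B C] C(1) unfolding v(2) by linarith
    moreover have "v \<in> carrier H" using v(1) by (simp add: orth_complement_def)
    ultimately show ?thesis using p B[of m] v(2) by (meson order_trans)
  qed
  then obtain v where v: "\<And>m. v m \<in> carrier H" "\<And>m. w m \<ominus>\<^bsub>K\<^esub> T (v m) \<in> coker_space"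
    "\<And>m. hnorm H (v m) \<le> C * B" "\<And>m. hnorm K (w m \<ominus>\<^bsub>K\<^esub> T (v m)) \<le> B"
    by metis
  have bd: "hbounded K (\<lambda>m. w m \<ominus>\<^bsub>K\<^esub> T (v m))"
    using v wc unfolding hbounded_def by auto
  then obtain r :: "nat \<Rightarrow> nat" where r: "strict_mono r" "hcauchy K ((\<lambda>m. w m \<ominus>\<^bsub>K\<^esub> T (v m)) \<circ> r)"
    using K.finite_dim_cauchy_subseq[OF K.orth_complement_subspace[OF Rc] fin bd v(2)] by blast
  define y where "y m = (-1) \<odot>\<^bsub>H\<^esub> v (r m)" for m
  have "hbounded H y"
    using v(1,3) unfolding hbounded_def y_def by (auto simp: H.hnorm_smult)
  moreover have "hcauchy K (\<lambda>m. w (r m) \<oplus>\<^bsub>K\<^esub> T (y m))"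
    using r(2) v(1) wc by (simp add: y_def op_smult o_def K.minus_eq_smult)
  ultimately show ?thesis using that r(1) by blast
qed

end

lemma upper_semi_fredholm_iff:
  assumes "complex_hilbert_space H" "T \<in> bounded_ops H H"
  shows "T \<in> upper_semi_fredholm H \<longleftrightarrow> cauchy_reflecting H H T"
proof -
  interpret complex_hilbert_space H by fact
  interpret bounded_operator H H T by unfold_locales fact
  have "T \<in> upper_semi_fredholm H
      \<longleftrightarrow> \<not> cinfinite (hilbert_dim H (a_kernel H H T)) \<and> closed_in H (T ` carrier H)"
    using assms(2) by (simp add: upper_semi_fredholm_def nullity_def op_range_def)
  then show ?thesis
    using cauchy_reflecting_if_closed_range_finite_ker finite_ker_if_cauchy_reflecting
      closed_range_if_cauchy_reflecting by blast
qed

section \<open>Partial isometries between closed subspaces\<close>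

definition orthonormal_family :: "'a ip_space \<Rightarrow> 'i set \<Rightarrow> ('i \<Rightarrow> 'a) \<Rightarrow> bool" where
  "orthonormal_family H I e \<longleftrightarrow> (\<forall>i\<in>I. e i \<in> carrier H)
    \<and> (\<forall>i\<in>I. \<forall>j\<in>I. cinner H (e i) (e j) = (if i = j then 1 else 0))"

context complex_hilbert_space
begin

text \<open>
  The squared distance from \<open>x\<close> to its expansion over \<open>F\<close> is the difference of the two squared sides.
\<close>

lemma Bessel:
  assumes e: "orthonormal_family H I e" and F: "finite F" "F \<subseteq> I" and x: "x \<in> carrier H"
  shows "L2_set (\<lambda>i. cmod (cinner H x (e i))) F \<le> hnorm H x"
proof -
  have ec: "e i \<in> carrier H" if "i \<in> F" for i
    using e F(2) that by (auto simp: orthonormal_family_def)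
  define \<sigma> where "\<sigma> = (\<Sum>i\<in>F. (cmod (cinner H x (e i)))\<^sup>2)"
  define s where "s = (\<Oplus>i\<in>F. cinner H x (e i) \<odot> e i)"
  have sc: "s \<in> carrier H" unfolding s_def using ec by (intro finsum_closed) auto
  have sy: "cinner H s y = (\<Sum>i\<in>F. cinner H x (e i) * cinner H (e i) y)" if y: "y \<in> carrier H" for y
  proof -
    have "cinner H s y = (\<Sum>i\<in>F. cinner H (cinner H x (e i) \<odot> e i) y)"
      unfolding s_def using ec y F(1) by (intro cinner_finsum_left) auto
    also have "\<dots> = (\<Sum>i\<in>F. cinner H x (e i) * cinner H (e i) y)"
      using ec y by (intro sum.cong) (auto simp: cinner_smult_left)
    finally show ?thesis .
  qed
  have se: "cinner H s (e j) = cinner H x (e j)" if j: "j \<in> F" for j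
  proof -
    have "cinner H s (e j) = (\<Sum>i\<in>F. if i = j then cinner H x (e j) else 0)"
      unfolding sy[OF ec[OF j]]
      using e F(2) j by (intro sum.cong) (auto simp: orthonormal_family_def subset_iff)
    then show ?thesis using j F(1) by simp
  qed
  have \<sigma>: "(\<Sum>i\<in>F. cinner H x (e i) * cnj (cinner H x (e i))) = of_real \<sigma>"
    by (simp add: \<sigma>_def flip: complex_norm_square)
  have "cinner H s x = of_real \<sigma>"
    unfolding sy[OF x] \<sigma>[symmetric]
    by (intro sum.cong refl arg_cong2[of _ _ _ _ "(*)"] cinner_commute x ec)
  then have "cinner H x s = of_real \<sigma>" using cinner_commute[OF sc x] by simp
  moreover have "cinner H s s = of_real \<sigma>"
    unfolding sy[OF sc] \<sigma>[symmetric]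
  proof (intro sum.cong refl arg_cong2[of _ _ _ _ "(*)"])
    fix i assume i: "i \<in> F"
    show "cinner H (e i) s = cnj (cinner H x (e i))"
      using se[OF i] cinner_commute[OF sc ec[OF i]] by simp
  qed
  ultimately have "(hnorm H (x \<ominus> s))\<^sup>2 = (hnorm H x)\<^sup>2 - \<sigma>"
    using hnorm_minus_square[OF x sc] hnorm_square[OF sc] by simp
  then have "\<sigma> \<le> (hnorm H x)\<^sup>2" by (metis diff_ge_0_iff_ge zero_le_power2)
  then show ?thesis
    using x unfolding L2_set_def \<sigma>_def[symmetric] by (simp add: real_le_lsqrt)
qed

end

locale two_orthonormal_families = H: complex_hilbert_space H + K: complex_hilbert_space K
  for H :: "'a ip_space" and K :: "'b ip_space" +
  fixes I :: "'i set" and e :: "'i \<Rightarrow> 'a" and f :: "'i \<Rightarrow> 'b"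
  assumes e: "orthonormal_family H I e" and f: "orthonormal_family K I f"
begin

definition form :: "'a \<Rightarrow> 'b \<Rightarrow> complex" where
  "form x z = (\<Sum>\<^sub>\<infinity>i\<in>I. cinner H x (e i) * cinner K (f i) z)"

lemma family_closed: "i \<in> I \<Longrightarrow> e i \<in> carrier H" "i \<in> I \<Longrightarrow> f i \<in> carrier K"
  using e f by (auto simp: orthonormal_family_def)

lemma
  assumes x: "x \<in> carrier H" and z: "z \<in> carrier K"
  shows form_summable: "(\<lambda>i. cinner H x (e i) * cinner K (f i) z) summable_on I"
    and form_bound: "cmod (form x z) \<le> hnorm H x * hnorm K z"
proof -
  let ?g = "\<lambda>i. cinner H x (e i) * cinner K (f i) z"
  have fin: "(\<Sum>i\<in>F. cmod (?g i)) \<le> hnorm H x * hnorm K z" if F: "finite F" "F \<subseteq> I" for F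
  proof -
    have "(\<Sum>i\<in>F. cmod (?g i)) = (\<Sum>i\<in>F. \<bar>cmod (cinner H x (e i))\<bar> * \<bar>cmod (cinner K z (f i))\<bar>)"
    proof (rule sum.cong)
      fix i assume "i \<in> F"
      then have "f i \<in> carrier K" using F(2) family_closed(2) by blast
      then show "cmod (?g i) = \<bar>cmod (cinner H x (e i))\<bar> * \<bar>cmod (cinner K z (f i))\<bar>"
        using K.cinner_commute[OF z, of "f i"] by (simp add: norm_mult)
    qed simp
    also have "\<dots> \<le> L2_set (\<lambda>i. cmod (cinner H x (e i))) F * L2_set (\<lambda>i. cmod (cinner K z (f i))) F"
      by (rule L2_set_mult_ineq)
    also have "\<dots> \<le> hnorm H x * hnorm K z"
      using H.Bessel[OF e F x] K.Bessel[OF f F z] x by (intro mult_mono) (auto simp: L2_set_nonneg)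
    finally show ?thesis .
  qed
  have abs: "(\<lambda>i. cmod (?g i)) summable_on I"
    by (rule nonneg_bdd_above_summable_on)
      (use fin in \<open>auto intro!: bdd_aboveI2[where M = "hnorm H x * hnorm K z"]\<close>)
  then show "?g summable_on I" by (rule abs_summable_summable)
  have "cmod (form x z) \<le> (\<Sum>\<^sub>\<infinity>i\<in>I. cmod (?g i))"
    unfolding form_def by (rule norm_infsum_bound) (use abs in simp)
  also have "\<dots> \<le> hnorm H x * hnorm K z"
    using abs fin by (intro infsum_le_finite_sums) auto
  finally show "cmod (form x z) \<le> hnorm H x * hnorm K z" .
qed

lemma form_add_left:
  assumes "x \<in> carrier H" "y \<in> carrier H" "z \<in> carrier K"
  shows "form (x \<oplus>\<^bsub>H\<^esub> y) z = form x z + form y z"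
proof -
  have "form (x \<oplus>\<^bsub>H\<^esub> y) z
      = (\<Sum>\<^sub>\<infinity>i\<in>I. cinner H x (e i) * cinner K (f i) z + cinner H y (e i) * cinner K (f i) z)"
    unfolding form_def using assms family_closed
    by (intro infsum_cong) (simp add: H.cinner_simps algebra_simps)
  then show ?thesis
    unfolding form_def using assms form_summable by (simp add: infsum_add)
qed

lemma form_smult_left:
  assumes "x \<in> carrier H" "z \<in> carrier K"
  shows "form (c \<odot>\<^bsub>H\<^esub> x) z = c * form x z"
proof -
  have "form (c \<odot>\<^bsub>H\<^esub> x) z = (\<Sum>\<^sub>\<infinity>i\<in>I. c * (cinner H x (e i) * cinner K (f i) z))"
    unfolding form_def using assms family_closed
    by (intro infsum_cong) (simp add: H.cinner_simps)
  then show ?thesis unfolding form_def by (simp add: infsum_cmult_right')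
qed

lemma form_add_right:
  assumes "x \<in> carrier H" "y \<in> carrier K" "z \<in> carrier K"
  shows "form x (y \<oplus>\<^bsub>K\<^esub> z) = form x y + form x z"
proof -
  have "form x (y \<oplus>\<^bsub>K\<^esub> z)
      = (\<Sum>\<^sub>\<infinity>i\<in>I. cinner H x (e i) * cinner K (f i) y + cinner H x (e i) * cinner K (f i) z)"
    unfolding form_def using assms family_closed
    by (intro infsum_cong) (simp add: K.cinner_simps algebra_simps)
  then show ?thesis
    unfolding form_def using assms form_summable by (simp add: infsum_add)
qed

lemma form_smult_right:
  assumes "x \<in> carrier H" "z \<in> carrier K"
  shows "form x (c \<odot>\<^bsub>K\<^esub> z) = cnj c * form x z"
proof -
  have "form x (c \<odot>\<^bsub>K\<^esub> z) = (\<Sum>\<^sub>\<infinity>i\<in>I. cnj c * (cinner H x (e i) * cinner K (f i) z))"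
    unfolding form_def using assms family_closed
    by (intro infsum_cong) (simp add: K.cinner_simps)
  then show ?thesis unfolding form_def by (simp add: infsum_cmult_right')
qed

text \<open>
  The operator \<open>x \<mapsto> \<Sum>i. \<langle>x, e\<^sub>i\<rangle> f\<^sub>i\<close>.  It is defined through its sesquilinear form, so that only series of
  complex numbers occur.
\<close>

lemma transfer_operator:
  obtains J where "J \<in> bounded_ops H K" "\<And>x. x \<in> carrier H \<Longrightarrow> hnorm K (J x) \<le> hnorm H x"
    "\<And>x z. \<lbrakk>x \<in> carrier H; z \<in> carrier K\<rbrakk> \<Longrightarrow> cinner K (J x) z = form x z"
proof -
  have "\<exists>y. y \<in> carrier K \<and> (\<forall>z\<in>carrier K. cinner K y z = form x z)" if x: "x \<in> carrier H" for x
  proof (rule K.Riesz[of "\<lambda>z. cnj (form x z)" "hnorm H x"])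
    fix y assume y: "y \<in> carrier K" "\<And>z. z \<in> carrier K \<Longrightarrow> cnj (form x z) = cinner K z y"
    have "cinner K y z = form x z" if z: "z \<in> carrier K" for z
      using K.cinner_commute[OF z y(1)] y(2)[OF z, symmetric] by simp
    then show ?thesis using y(1) by blast
  qed (use x form_bound in \<open>simp_all add: form_add_right form_smult_right\<close>)
  then obtain J where J: "\<And>x. x \<in> carrier H \<Longrightarrow> J x \<in> carrier K"
    "\<And>x z. \<lbrakk>x \<in> carrier H; z \<in> carrier K\<rbrakk> \<Longrightarrow> cinner K (J x) z = form x z"
    by metis
  have bound: "hnorm K (J x) \<le> hnorm H x" if x: "x \<in> carrier H" for x
  proof (cases "hnorm K (J x) = 0")
    case False
    then have n: "hnorm K (J x) > 0" using K.hnorm_nonneg[OF J(1)[OF x]] by simp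
    have "of_real ((hnorm K (J x))\<^sup>2) = form x (J x)"
      using J(2)[OF x J(1)[OF x]] K.cinner_self[OF J(1)[OF x]] by simp
    then have "(hnorm K (J x))\<^sup>2 \<le> hnorm H x * hnorm K (J x)"
      using form_bound[OF x J(1)[OF x]] by (metis norm_of_real abs_of_nonneg zero_le_power2)
    then show ?thesis using n by (simp add: power2_eq_square)
  qed (use x in simp)
  have "J \<in> bounded_ops H K"
    unfolding bounded_ops_def
  proof (intro CollectI conjI ballI allI exI)
    show "J \<in> carrier H \<rightarrow> carrier K" using J(1) by blast
    show "J (x \<oplus>\<^bsub>H\<^esub> y) = J x \<oplus>\<^bsub>K\<^esub> J y" if "x \<in> carrier H" "y \<in> carrier H" for x y
      by (rule K.cinner_ext) (use that in \<open>simp_all add: J form_add_left K.cinner_add_left\<close>)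
    show "J (c \<odot>\<^bsub>H\<^esub> x) = c \<odot>\<^bsub>K\<^esub> J x" if "x \<in> carrier H" for c x
      by (rule K.cinner_ext) (use that in \<open>simp_all add: J form_smult_left K.cinner_smult_left\<close>)
    show "hnorm K (J x) \<le> 1 * hnorm H x" if "x \<in> carrier H" for x using bound[OF that] by simp
  qed
  then show ?thesis using bound J(2) by (rule that)
qed

lemma form_coefficient:
  assumes "x \<in> carrier H" "j \<in> I" shows "form x (f j) = cinner H x (e j)"
proof -
  have "form x (f j) = (\<Sum>\<^sub>\<infinity>i\<in>{j}. cinner H x (e i) * cinner K (f i) (f j))"
    unfolding form_def using f assms(2)
    by (intro infsum_cong_neutral) (auto simp: orthonormal_family_def)
  then show ?thesis using f assms(2) by (simp add: orthonormal_family_def)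
qed

lemma form_eq_0: "(\<And>i. i \<in> I \<Longrightarrow> cinner K (f i) z = 0) \<Longrightarrow> form x z = 0"
  unfolding form_def by (simp add: infsum_0)

end

text \<open>
  The isometry on \<open>S\<close> maps one basis into the other.  Composed with the analogous contraction in the opposite
  direction it is the identity on \<open>S\<close>; as neither map increases norms, it cannot decrease them on \<open>S\<close>.
\<close>

lemma partial_isometry_exists:
  assumes "complex_hilbert_space H" "complex_hilbert_space K"
    and S: "linear_subspace H S" "closed_in H S" and R: "linear_subspace K R"
    and dim: "hilbert_dim H S \<le>o hilbert_dim K R"
  obtains J where "J \<in> bounded_ops H K" "\<And>x. x \<in> S \<Longrightarrow> hnorm H x \<le> hnorm K (J x)"
    "\<And>x z. \<lbrakk>x \<in> carrier H; z \<in> carrier K; \<And>y. y \<in> R \<Longrightarrow> cinner K y z = 0\<rbrakk> \<Longrightarrow> cinner K (J x) z = 0"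
proof -
  interpret H: complex_hilbert_space H by fact
  interpret K: complex_hilbert_space K by fact
  note SD = H.linear_subspaceD[OF S(1)] and RD = K.linear_subspaceD[OF R]
  obtain B where B: "orthonormal_basis H S B" "hilbert_dim H S = |B|"
    using H.hilbert_dim_basis[of S] SD by blast
  obtain B' where B': "orthonormal_basis K R B'" "hilbert_dim K R = |B'|"
    using K.hilbert_dim_basis[of R] RD by blast
  obtain f where f: "inj_on f B" "f ` B \<subseteq> B'"
    using dim unfolding B(2) B'(2) card_of_ordLeq[symmetric] by blast
  note BD = H.orthonormal_basisD[OF B(1) SD(1)] and BD' = K.orthonormal_basisD[OF B'(1) RD(1)]
  have onH: "orthonormal_family H B (\<lambda>b. b)"
    using BD(2) by (auto simp: orthonormal_family_def H.orthonormal_def)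
  have fB: "f b \<in> B'" if "b \<in> B" for b using f(2) that by blast
  have onK: "orthonormal_family K B f"
    unfolding orthonormal_family_def
  proof (intro conjI ballI)
    show "f b \<in> carrier K" if "b \<in> B" for b
      using BD'(2) fB[OF that] by (auto simp: K.orthonormal_def)
    show "cinner K (f b) (f c) = (if b = c then 1 else 0)" if "b \<in> B" "c \<in> B" for b c
    proof -
      have "cinner K (f b) (f c) = (if f b = f c then 1 else 0)"
        using BD'(2) fB[OF that(1)] fB[OF that(2)] unfolding K.orthonormal_def by blast
      then show ?thesis using inj_on_eq_iff[OF f(1) that] by simp
    qed
  qed
  interpret two_orthonormal_families H K B "\<lambda>b. b" f
    by (intro two_orthonormal_families.intro two_orthonormal_families_axioms.intro assms(1,2) onH onK)
  interpret adj: two_orthonormal_families K H B f "\<lambda>b. b"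
    by (intro two_orthonormal_families.intro two_orthonormal_families_axioms.intro assms(1,2) onH onK)
  obtain J where J: "J \<in> bounded_ops H K" "\<And>x. x \<in> carrier H \<Longrightarrow> hnorm K (J x) \<le> hnorm H x"
    "\<And>x z. \<lbrakk>x \<in> carrier H; z \<in> carrier K\<rbrakk> \<Longrightarrow> cinner K (J x) z = form x z"
    using transfer_operator by metis
  obtain J' where J': "J' \<in> bounded_ops K H" "\<And>y. y \<in> carrier K \<Longrightarrow> hnorm H (J' y) \<le> hnorm K y"
    "\<And>y z. \<lbrakk>y \<in> carrier K; z \<in> carrier H\<rbrakk> \<Longrightarrow> cinner H (J' y) z = adj.form y z"
    using adj.transfer_operator by metis
  interpret J: bounded_operator H K J by unfold_locales (rule J(1))
  interpret J': bounded_operator K H J' by unfold_locales (rule J'(1))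
  have "hnorm H x \<le> hnorm K (J x)" if x: "x \<in> S" for x
  proof -
    have xc: "x \<in> carrier H" using x SD(1) by blast
    define y where "y = J' (J x)"
    have yc: "y \<in> carrier H" using xc by (simp add: y_def)
    have "y \<in> S"
    proof (rule H.orth_complement_twice[OF S yc])
      fix z assume z: "z \<in> orth_complement H S"
      then have zc: "z \<in> carrier H" by (simp add: orth_complement_def)
      have "cinner H b z = 0" if "b \<in> B" for b
      proof -
        have "b \<in> S" "b \<in> carrier H" using that BD(1) SD(1) by auto
        then show ?thesis using z H.cinner_commute[OF zc, of b] by (simp add: orth_complement_def)
      qed
      then show "cinner H y z = 0"
        using J'(3) xc zc adj.form_eq_0 by (simp add: y_def)
    qed
    have "cinner H (y \<ominus>\<^bsub>H\<^esub> x) b = 0" if b: "b \<in> B" for b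
    proof -
      have "cinner H y b = cinner K (J x) (f b)"
        using J'(3)[of "J x" b] xc b adj.form_coefficient[of "J x" b] family_closed(1)[OF b]
        by (simp add: y_def)
      also have "\<dots> = cinner H x b"
        using J(3)[OF xc family_closed(2)[OF b]] form_coefficient[OF xc b] by simp
      finally show ?thesis using xc yc family_closed(1)[OF b] by (simp add: H.cinner_minus_left)
    qed
    then have "y \<ominus>\<^bsub>H\<^esub> x = \<zero>\<^bsub>H\<^esub>" using BD(3)[OF SD(5)[OF \<open>y \<in> S\<close> x]] by blast
    then have "y = x" using xc yc by (simp add: H.minus_eq_zero_iff)
    then show ?thesis using J'(2)[of "J x"] xc by (simp add: y_def)
  qed
  moreover have "cinner K (J x) z = 0"
    if "x \<in> carrier H" "z \<in> carrier K" "\<And>y. y \<in> R \<Longrightarrow> cinner K y z = 0" for x z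
  proof -
    have "cinner K (f b) z = 0" if "b \<in> B" for b
      using \<open>\<And>y. y \<in> R \<Longrightarrow> cinner K y z = 0\<close> fB[OF that] BD'(1) by blast
    then show ?thesis using J(3)[OF that(1,2)] form_eq_0 by simp
  qed
  ultimately show ?thesis using that J(1) by blast
qed

section \<open>Finite direct sums\<close>

locale hilbert_family =
  fixes n :: nat and H :: "nat \<Rightarrow> 'a ip_space"
  assumes hilbert: "s \<in> {1..n} \<Longrightarrow> complex_hilbert_space (H s)"
begin

abbreviation DS :: "(nat \<Rightarrow> 'a) ip_space" where "DS \<equiv> direct_sum n H"

lemma pre_hilbert: assumes "s \<in> {1..n}" shows "pre_hilbert (H s)"
proof -
  interpret complex_hilbert_space "H s" by (rule hilbert[OF assms])
  show ?thesis by (rule pre_hilbert_axioms)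
qed

lemma carrier_DS: "carrier DS = (\<Pi>\<^sub>E i\<in>{1..n}. carrier (H i))"
  and zero_DS: "\<zero>\<^bsub>DS\<^esub> = (\<lambda>i\<in>{1..n}. \<zero>\<^bsub>H i\<^esub>)"
  and add_DS: "x \<oplus>\<^bsub>DS\<^esub> y = (\<lambda>i\<in>{1..n}. x i \<oplus>\<^bsub>H i\<^esub> y i)"
  and smult_DS: "c \<odot>\<^bsub>DS\<^esub> x = (\<lambda>i\<in>{1..n}. c \<odot>\<^bsub>H i\<^esub> x i)"
  and cinner_DS: "cinner DS x y = (\<Sum>i\<in>{1..n}. cinner (H i) (x i) (y i))"
  by (simp_all add: direct_sum_def)

lemma DS_component: "x \<in> carrier DS \<Longrightarrow> i \<in> {1..n} \<Longrightarrow> x i \<in> carrier (H i)"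
  by (auto simp: carrier_DS)

lemma DS_ext:
  "x \<in> carrier DS \<Longrightarrow> y \<in> carrier DS \<Longrightarrow> (\<And>i. i \<in> {1..n} \<Longrightarrow> x i = y i) \<Longrightarrow> x = y"
  unfolding carrier_DS by (rule PiE_ext)

lemma DS_memI: "(\<And>i. i \<in> {1..n} \<Longrightarrow> f i \<in> carrier (H i)) \<Longrightarrow> (\<lambda>i\<in>{1..n}. f i) \<in> carrier DS"
  by (auto simp: carrier_DS)

lemma zero_DS_component: "i \<in> {1..n} \<Longrightarrow> \<zero>\<^bsub>DS\<^esub> i = \<zero>\<^bsub>H i\<^esub>"
  and add_DS_component: "i \<in> {1..n} \<Longrightarrow> (x \<oplus>\<^bsub>DS\<^esub> y) i = x i \<oplus>\<^bsub>H i\<^esub> y i"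
  and smult_DS_component: "i \<in> {1..n} \<Longrightarrow> (c \<odot>\<^bsub>DS\<^esub> x) i = c \<odot>\<^bsub>H i\<^esub> x i"
  by (simp_all add: zero_DS add_DS smult_DS)

lemma DS_module: "module (ring_of_type_algebra :: complex ring) DS"
proof (rule moduleI)
  note comp = zero_DS_component add_DS_component smult_DS_component
  have M: "module (ring_of_type_algebra :: complex ring) (H i)" if "i \<in> {1..n}" for i
    using hilbert[OF that] by (simp add: complex_hilbert_space_def)
  have G: "abelian_group (H i)" if "i \<in> {1..n}" for i
    using M[OF that] by (simp add: module_def)
  show "cring (ring_of_type_algebra :: complex ring)" ..
  have add_closed: "x \<oplus>\<^bsub>DS\<^esub> y \<in> carrier DS" if "x \<in> carrier DS" "y \<in> carrier DS" for x y
    unfolding add_DS using that DS_component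
    by (intro DS_memI abelian_monoid.a_closed abelian_group.axioms(1) G)
  have zero_closed: "\<zero>\<^bsub>DS\<^esub> \<in> carrier DS"
    unfolding zero_DS
    by (intro DS_memI abelian_monoid.zero_closed abelian_group.axioms(1) G)
  have smult_closed: "c \<odot>\<^bsub>DS\<^esub> x \<in> carrier DS" if "x \<in> carrier DS" for c x
    unfolding smult_DS using that DS_component
    by (intro DS_memI pre_hilbert.smult_in_carrier pre_hilbert)
  show "abelian_group DS"
  proof (rule abelian_groupI)
    fix x y z assume x: "x \<in> carrier DS" and y: "y \<in> carrier DS" and z: "z \<in> carrier DS"
    show "(x \<oplus>\<^bsub>DS\<^esub> y) \<oplus>\<^bsub>DS\<^esub> z = x \<oplus>\<^bsub>DS\<^esub> (y \<oplus>\<^bsub>DS\<^esub> z)"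
      by (rule DS_ext) (use x y z DS_component in \<open>simp_all add: add_closed comp
        abelian_monoid.a_assoc[OF abelian_group.axioms(1)[OF G]]\<close>)
    show "x \<oplus>\<^bsub>DS\<^esub> y = y \<oplus>\<^bsub>DS\<^esub> x"
      by (rule DS_ext) (use x y DS_component in \<open>simp_all add: add_closed comp
        abelian_monoid.a_comm[OF abelian_group.axioms(1)[OF G]]\<close>)
    show "\<zero>\<^bsub>DS\<^esub> \<oplus>\<^bsub>DS\<^esub> x = x"
      by (rule DS_ext) (use x DS_component in \<open>simp_all add: add_closed zero_closed comp
        abelian_monoid.l_zero[OF abelian_group.axioms(1)[OF G]]\<close>)
    have "(-1) \<odot>\<^bsub>DS\<^esub> x \<oplus>\<^bsub>DS\<^esub> x = \<zero>\<^bsub>DS\<^esub>"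
    proof (rule DS_ext)
      fix i assume i: "i \<in> {1..n}"
      interpret pre_hilbert "H i" by (rule pre_hilbert[OF i])
      show "((-1) \<odot>\<^bsub>DS\<^esub> x \<oplus>\<^bsub>DS\<^esub> x) i = \<zero>\<^bsub>DS\<^esub> i"
        unfolding comp[OF i]
        by (rule cinner_ext) (use DS_component[OF x i] in \<open>simp_all add: cinner_simps\<close>)
    qed (use x in \<open>simp_all add: add_closed smult_closed zero_closed\<close>)
    then show "\<exists>y\<in>carrier DS. y \<oplus>\<^bsub>DS\<^esub> x = \<zero>\<^bsub>DS\<^esub>" using smult_closed[OF x] by blast
  qed (simp_all add: add_closed zero_closed)
  fix a b :: complex and x y assume x: "x \<in> carrier DS" and y: "y \<in> carrier DS"
  show "a \<odot>\<^bsub>DS\<^esub> x \<in> carrier DS" by (rule smult_closed[OF x])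
  have R: "a \<oplus>\<^bsub>ring_of_type_algebra\<^esub> b = a + b" "a \<otimes>\<^bsub>ring_of_type_algebra\<^esub> b = a * b"
    "\<one>\<^bsub>ring_of_type_algebra\<^esub> = (1::complex)"
    by (simp_all add: ring_of_type_algebra_def)
  show "(a \<oplus>\<^bsub>ring_of_type_algebra\<^esub> b) \<odot>\<^bsub>DS\<^esub> x = a \<odot>\<^bsub>DS\<^esub> x \<oplus>\<^bsub>DS\<^esub> b \<odot>\<^bsub>DS\<^esub> x"
    unfolding R
  proof (rule DS_ext)
    fix i assume i: "i \<in> {1..n}"
    interpret pre_hilbert "H i" by (rule pre_hilbert[OF i])
    show "((a + b) \<odot>\<^bsub>DS\<^esub> x) i = (a \<odot>\<^bsub>DS\<^esub> x \<oplus>\<^bsub>DS\<^esub> b \<odot>\<^bsub>DS\<^esub> x) i"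
      unfolding comp[OF i]
      by (rule cinner_ext) (use DS_component[OF x i] in \<open>simp_all add: cinner_simps algebra_simps\<close>)
  qed (use x in \<open>simp_all add: add_closed smult_closed\<close>)
  show "a \<odot>\<^bsub>DS\<^esub> (x \<oplus>\<^bsub>DS\<^esub> y) = a \<odot>\<^bsub>DS\<^esub> x \<oplus>\<^bsub>DS\<^esub> a \<odot>\<^bsub>DS\<^esub> y"
  proof (rule DS_ext)
    fix i assume i: "i \<in> {1..n}"
    interpret pre_hilbert "H i" by (rule pre_hilbert[OF i])
    show "(a \<odot>\<^bsub>DS\<^esub> (x \<oplus>\<^bsub>DS\<^esub> y)) i = (a \<odot>\<^bsub>DS\<^esub> x \<oplus>\<^bsub>DS\<^esub> a \<odot>\<^bsub>DS\<^esub> y) i"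
      unfolding comp[OF i]
      by (rule cinner_ext)
        (use DS_component[OF x i] DS_component[OF y i] in \<open>simp_all add: cinner_simps algebra_simps\<close>)
  qed (use x y in \<open>simp_all add: add_closed smult_closed\<close>)
  show "(a \<otimes>\<^bsub>ring_of_type_algebra\<^esub> b) \<odot>\<^bsub>DS\<^esub> x = a \<odot>\<^bsub>DS\<^esub> (b \<odot>\<^bsub>DS\<^esub> x)"
    unfolding R
  proof (rule DS_ext)
    fix i assume i: "i \<in> {1..n}"
    interpret pre_hilbert "H i" by (rule pre_hilbert[OF i])
    show "((a * b) \<odot>\<^bsub>DS\<^esub> x) i = (a \<odot>\<^bsub>DS\<^esub> (b \<odot>\<^bsub>DS\<^esub> x)) i"
      unfolding comp[OF i]
      by (rule cinner_ext) (use DS_component[OF x i] in \<open>simp_all add: cinner_simps\<close>)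
  qed (use x in \<open>simp_all add: smult_closed\<close>)
  show "\<one>\<^bsub>ring_of_type_algebra\<^esub> \<odot>\<^bsub>DS\<^esub> x = x"
    unfolding R
  proof (rule DS_ext)
    fix i assume i: "i \<in> {1..n}"
    interpret pre_hilbert "H i" by (rule pre_hilbert[OF i])
    show "(1 \<odot>\<^bsub>DS\<^esub> x) i = x i"
      unfolding comp[OF i]
      by (rule cinner_ext) (use DS_component[OF x i] in \<open>simp_all add: cinner_simps\<close>)
  qed (use x in \<open>simp_all add: smult_closed\<close>)
qed

lemma DS_pre_hilbert: "pre_hilbert DS"
proof -
  interpret module "ring_of_type_algebra :: complex ring" DS by (rule DS_module)
  show ?thesis
  proof
    fix x y z :: "nat \<Rightarrow> 'a" and c :: complex
    assume x: "x \<in> carrier DS"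
    { assume y: "y \<in> carrier DS"
      { assume z: "z \<in> carrier DS"
        have "cinner (H i) ((x \<oplus>\<^bsub>DS\<^esub> y) i) (z i) = cinner (H i) (x i) (z i) + cinner (H i) (y i) (z i)"
          if i: "i \<in> {1..n}" for i
          unfolding add_DS_component[OF i]
          by (intro pre_hilbert.cinner_add_left pre_hilbert i DS_component x y z)
        then show "cinner DS (x \<oplus>\<^bsub>DS\<^esub> y) z = cinner DS x z + cinner DS y z"
          by (simp add: cinner_DS sum.distrib) }
      have "cinner (H i) ((c \<odot>\<^bsub>DS\<^esub> x) i) (y i) = c * cinner (H i) (x i) (y i)" if i: "i \<in> {1..n}" for i
        unfolding smult_DS_component[OF i]
        by (intro pre_hilbert.cinner_smult_left pre_hilbert i DS_component x y)
      then show "cinner DS (c \<odot>\<^bsub>DS\<^esub> x) y = c * cinner DS x y"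
        by (simp add: cinner_DS sum_distrib_left)
      have "cinner (H i) (y i) (x i) = cnj (cinner (H i) (x i) (y i))" if i: "i \<in> {1..n}" for i
        by (intro pre_hilbert.cinner_commute pre_hilbert i DS_component x y)
      then show "cinner DS y x = cnj (cinner DS x y)" by (simp add: cinner_DS) }
    assume "x \<noteq> \<zero>\<^bsub>DS\<^esub>"
    then obtain i where i: "i \<in> {1..n}" "x i \<noteq> \<zero>\<^bsub>H i\<^esub>"
      using DS_ext[OF x zero_closed] zero_DS_component by metis
    have "0 < (\<Sum>j\<in>{1..n}. Re (cinner (H j) (x j) (x j)))"
    proof (rule sum_pos2[OF _ i(1)])
      show "0 < Re (cinner (H i) (x i) (x i))"
        by (intro pre_hilbert.cinner_pos pre_hilbert DS_component x i)
      show "0 \<le> Re (cinner (H j) (x j) (x j))" if "j \<in> {1..n}" for j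
        by (intro pre_hilbert.cinner_self_nonneg pre_hilbert DS_component x that)
    qed simp
    then show "Re (cinner DS x x) > 0" by (simp add: cinner_DS)
  qed
qed

sublocale pre: pre_hilbert DS by (rule DS_pre_hilbert)

text \<open>
  Subtraction is defined through inverses with respect to the addition, so this is not immediate from the
  componentwise addition.
\<close>

lemma minus_DS_component:
  assumes x: "x \<in> carrier DS" and y: "y \<in> carrier DS" and i: "i \<in> {1..n}"
  shows "(x \<ominus>\<^bsub>DS\<^esub> y) i = x i \<ominus>\<^bsub>H i\<^esub> y i"
proof -
  interpret pre_hilbert "H i" by (rule pre_hilbert[OF i])
  show ?thesis
    unfolding pre.minus_eq_smult[OF x y] add_DS_component[OF i] smult_DS_component[OF i]
    using minus_eq_smult[OF DS_component[OF x i] DS_component[OF y i]] by simp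
qed

lemma hnorm_DS:
  assumes "x \<in> carrier DS"
  shows "hnorm DS x = L2_set (\<lambda>i. hnorm (H i) (x i)) {1..n}"
proof -
  have "Re (cinner (H i) (x i) (x i)) = (hnorm (H i) (x i))\<^sup>2" if "i \<in> {1..n}" for i
    using pre_hilbert.hnorm_square[OF pre_hilbert DS_component] assms that by simp
  then show ?thesis unfolding hnorm_def[of DS] L2_set_def by (simp add: cinner_DS)
qed

lemma hnorm_component_le:
  assumes "x \<in> carrier DS" "i \<in> {1..n}" shows "hnorm (H i) (x i) \<le> hnorm DS x"
  unfolding hnorm_DS[OF assms(1)] using assms(2) by (intro member_le_L2_set) auto

lemma hnorm_DS_le_sum:
  assumes "x \<in> carrier DS" shows "hnorm DS x \<le> (\<Sum>i\<in>{1..n}. hnorm (H i) (x i))"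
  unfolding hnorm_DS[OF assms]
  using pre_hilbert.hnorm_nonneg[OF pre_hilbert DS_component] assms by (intro L2_set_le_sum) auto

lemma hcauchy_component:
  assumes x: "hcauchy DS x" and i: "i \<in> {1..n}" shows "hcauchy (H i) (\<lambda>m. x m i)"
proof (rule hcauchy_dominated[OF x])
  note xc = hcauchyD[OF x]
  show "hnorm (H i) (x m i \<ominus>\<^bsub>H i\<^esub> x k i) \<le> 1 * hnorm DS (x m \<ominus>\<^bsub>DS\<^esub> x k)" for m k
    using hnorm_component_le[of "x m \<ominus>\<^bsub>DS\<^esub> x k" i] xc i by (simp add: minus_DS_component)
qed (use hcauchyD[OF x] i in \<open>auto intro: DS_component DS_pre_hilbert\<close>)

lemma hcauchy_DS_iff:
  "hcauchy DS x \<longleftrightarrow> (\<forall>m. x m \<in> carrier DS) \<and> (\<forall>i\<in>{1..n}. hcauchy (H i) (\<lambda>m. x m i))"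
proof (intro iffI conjI allI ballI)
  assume "(\<forall>m. x m \<in> carrier DS) \<and> (\<forall>i\<in>{1..n}. hcauchy (H i) (\<lambda>m. x m i))"
  then have xc: "\<And>m. x m \<in> carrier DS" and ca: "\<And>i. i \<in> {1..n} \<Longrightarrow> hcauchy (H i) (\<lambda>m. x m i)" by auto
  show "hcauchy DS x"
  proof (rule pre.hcauchy_if_sum_dominated)
    show "\<exists>N. \<forall>m\<ge>N. \<forall>k\<ge>N. hnorm (H i) (x m i \<ominus>\<^bsub>H i\<^esub> x k i) < e" if "i \<in> {1..n}" "e > 0" for i and e :: real
      using ca that unfolding hcauchy_def by blast
    show "hnorm DS (x m \<ominus>\<^bsub>DS\<^esub> x k) \<le> (\<Sum>i\<in>{1..n}. hnorm (H i) (x m i \<ominus>\<^bsub>H i\<^esub> x k i))" for m k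
      using hnorm_DS_le_sum[of "x m \<ominus>\<^bsub>DS\<^esub> x k"] xc by (simp add: minus_DS_component)
  qed (use xc in auto)
qed (auto intro: hcauchyD hcauchy_component)

text \<open>
  A Cauchy sequence converges in every component, and the vector of the limits is its limit because the norm
  of a vector is at most the sum of the norms of its components.
\<close>

lemma DS_complex_hilbert_space: "complex_hilbert_space DS"
proof (intro complex_hilbert_space.intro complex_hilbert_space_axioms.intro)
  show "Metric_space.mcomplete (carrier DS) (hdist DS)"
    unfolding pre.metric.mcomplete_def
  proof (intro allI impI)
    fix x assume "pre.metric.MCauchy x"
    then have x: "hcauchy DS x" by (simp add: pre.hcauchy_iff_MCauchy)
    have "\<exists>l. hconv (H i) (\<lambda>m. x m i) l" if "i \<in> {1..n}" for i
      by (rule complex_hilbert_space.hcauchy_imp_hconv[OF hilbert[OF that] hcauchy_component[OF x that]])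
    then obtain l where l: "\<And>i. i \<in> {1..n} \<Longrightarrow> hconv (H i) (\<lambda>m. x m i) (l i)" by metis
    define L where "L = (\<lambda>i\<in>{1..n}. l i)"
    have L: "L \<in> carrier DS" unfolding L_def using hconvD(2)[OF l] by (intro DS_memI)
    note xc = hcauchyD[OF x]
    have "(\<lambda>m. \<Sum>i\<in>{1..n}. hnorm (H i) (x m i \<ominus>\<^bsub>H i\<^esub> l i)) \<longlonglongrightarrow> (\<Sum>i\<in>{1..n}. 0)"
      using l by (intro tendsto_sum) (simp add: hconv_def)
    then have lim0: "(\<lambda>m. \<Sum>i\<in>{1..n}. hnorm (H i) (x m i \<ominus>\<^bsub>H i\<^esub> l i)) \<longlonglongrightarrow> 0" by simp
    have "(\<lambda>m. hnorm DS (x m \<ominus>\<^bsub>DS\<^esub> L)) \<longlonglongrightarrow> 0"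
    proof (rule Lim_null_comparison[OF _ lim0])
      have "hnorm DS (x m \<ominus>\<^bsub>DS\<^esub> L) \<le> (\<Sum>i\<in>{1..n}. hnorm (H i) (x m i \<ominus>\<^bsub>H i\<^esub> l i))" for m
        using hnorm_DS_le_sum[of "x m \<ominus>\<^bsub>DS\<^esub> L"] xc L by (simp add: minus_DS_component L_def)
      then show "\<forall>\<^sub>F m in sequentially. norm (hnorm DS (x m \<ominus>\<^bsub>DS\<^esub> L))
          \<le> (\<Sum>i\<in>{1..n}. hnorm (H i) (x m i \<ominus>\<^bsub>H i\<^esub> l i))"
        using xc L by simp
    qed
    then have "hconv DS x L" using xc L by (simp add: hconv_def)
    then show "\<exists>l. limitin pre.metric.mtopology x l sequentially"
      by (auto simp: pre.hconv_iff_limitin)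
  qed
qed (auto intro: DS_module pre.cinner_add_left pre.cinner_smult_left pre.cinner_commute pre.cinner_pos)

lemma hbounded_component:
  assumes "hbounded DS x" "i \<in> {1..n}" shows "hbounded (H i) (\<lambda>m. x m i)"
proof -
  obtain C where C: "\<And>m. hnorm DS (x m) \<le> C" using assms(1) by (auto simp: hbounded_def)
  note xc = hboundedD[OF assms(1)]
  have "hnorm (H i) (x m i) \<le> C" for m
    using hnorm_component_le[OF xc assms(2)] C by (rule order_trans)
  then show ?thesis using DS_component[OF xc assms(2)] unfolding hbounded_def by blast
qed

definition embed :: "nat \<Rightarrow> 'a \<Rightarrow> nat \<Rightarrow> 'a" where
  "embed k y = (\<lambda>i\<in>{1..n}. if i = k then y else \<zero>\<^bsub>H i\<^esub>)"

lemma zero_component [simp]: "i \<in> {1..n} \<Longrightarrow> \<zero>\<^bsub>H i\<^esub> \<in> carrier (H i)"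
  by (metis DS_component pre.zero_closed zero_DS_component)

lemma embed_closed: "k \<in> {1..n} \<Longrightarrow> y \<in> carrier (H k) \<Longrightarrow> embed k y \<in> carrier DS"
  unfolding embed_def by (intro DS_memI) auto

lemma embed_component: "i \<in> {1..n} \<Longrightarrow> embed k y i = (if i = k then y else \<zero>\<^bsub>H i\<^esub>)"
  by (simp add: embed_def)

lemma hnorm_embed:
  assumes k: "k \<in> {1..n}" and y: "y \<in> carrier (H k)"
  shows "hnorm DS (embed k y) = hnorm (H k) y"
proof -
  have "hnorm (H i) (embed k y i) = (if i = k then hnorm (H k) y else 0)" if "i \<in> {1..n}" for i
    using pre_hilbert.hnorm_zero[OF pre_hilbert[OF that]] that by (simp add: embed_component)
  then have "(\<Sum>i\<in>{1..n}. hnorm (H i) (embed k y i)) = (\<Sum>i\<in>{1..n}. if i = k then hnorm (H k) y else 0)"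
    by (rule sum.cong[OF refl])
  then have "hnorm DS (embed k y) \<le> hnorm (H k) y"
    using hnorm_DS_le_sum[OF embed_closed[OF assms]] k by simp
  then show ?thesis
    using hnorm_component_le[OF embed_closed[OF assms] k] k by (simp add: embed_component)
qed

lemma hbounded_embed:
  assumes "k \<in> {1..n}" "hbounded (H k) y" shows "hbounded DS (\<lambda>m. embed k (y m))"
  using assms unfolding hbounded_def by (auto simp: embed_closed hnorm_embed)

end

section \<open>Upper triangular block operators\<close>

locale block_operator = hilbert_family n H
  for n :: nat and H :: "nat \<Rightarrow> 'a ip_space" +
  fixes D :: "nat \<Rightarrow> 'a \<Rightarrow> 'a" and A :: "nat \<Rightarrow> nat \<Rightarrow> 'a \<Rightarrow> 'a"
  assumes diagonal: "s \<in> {1..n} \<Longrightarrow> D s \<in> bounded_ops (H s) (H s)"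
    and blocks: "A \<in> block_tuples n H"
begin

abbreviation E :: "nat \<Rightarrow> nat \<Rightarrow> 'a \<Rightarrow> 'a" where "E \<equiv> upper_entry H D A"
abbreviation T :: "(nat \<Rightarrow> 'a) \<Rightarrow> nat \<Rightarrow> 'a" where "T \<equiv> upper_block_operator n H D A"

lemma entry_bounded_operator:
  assumes "i \<in> {1..n}" "j \<in> {1..n}" shows "bounded_operator (H j) (H i) (E i j)"
proof (intro bounded_operator.intro bounded_operator_axioms.intro hilbert assms)
  show "E i j \<in> bounded_ops (H j) (H i)"
    using diagonal pre_hilbert.zero_operator_bounded[OF pre_hilbert] assms blocks
    by (auto simp: upper_entry_def block_tuples_def)
qed

lemma entry_closed:
  "\<lbrakk>i \<in> {1..n}; j \<in> {1..n}; x \<in> carrier DS\<rbrakk> \<Longrightarrow> E i j (x j) \<in> carrier (H i)"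
  by (intro bounded_operator.op_closed[OF entry_bounded_operator] DS_component)

lemma T_component: "i \<in> {1..n} \<Longrightarrow> T x i = (\<Oplus>\<^bsub>H i\<^esub>j\<in>{1..n}. E i j (x j))"
  by (simp add: upper_block_operator_def)

lemma T_component_closed:
  assumes "x \<in> carrier DS" "i \<in> {1..n}" shows "T x i \<in> carrier (H i)"
proof -
  interpret pre_hilbert "H i" by (rule pre_hilbert[OF assms(2)])
  show ?thesis
    unfolding T_component[OF assms(2)] using entry_closed assms by (intro finsum_closed) auto
qed

lemma T_closed: "x \<in> carrier DS \<Longrightarrow> T x \<in> carrier DS"
  unfolding upper_block_operator_def
  using T_component_closed by (intro DS_memI) (simp add: T_component)

lemma cinner_T_component:
  assumes "x \<in> carrier DS" "i \<in> {1..n}" "z \<in> carrier (H i)"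
  shows "cinner (H i) (T x i) z = (\<Sum>j\<in>{1..n}. cinner (H i) (E i j (x j)) z)"
proof -
  interpret pre_hilbert "H i" by (rule pre_hilbert[OF assms(2)])
  show ?thesis
    unfolding T_component[OF assms(2)]
    using entry_closed assms by (intro cinner_finsum_left) auto
qed

lemma T_bounded: "T \<in> bounded_ops DS DS"
  unfolding bounded_ops_def
proof (intro CollectI conjI ballI allI)
  show "T \<in> carrier DS \<rightarrow> carrier DS" using T_closed by blast
  fix x assume x: "x \<in> carrier DS"
  show "T (c \<odot>\<^bsub>DS\<^esub> x) = c \<odot>\<^bsub>DS\<^esub> T x" for c
  proof (rule DS_ext)
    fix i assume i: "i \<in> {1..n}"
    interpret pre_hilbert "H i" by (rule pre_hilbert[OF i])
    have "cinner (H i) (E i j ((c \<odot>\<^bsub>DS\<^esub> x) j)) z = c * cinner (H i) (E i j (x j)) z"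
      if "j \<in> {1..n}" "z \<in> carrier (H i)" for j z
      using bounded_operator.op_smult[OF entry_bounded_operator[OF i that(1)] DS_component[OF x that(1)]]
        entry_closed[OF i that(1) x] that by (simp add: smult_DS_component cinner_smult_left)
    then show "T (c \<odot>\<^bsub>DS\<^esub> x) i = (c \<odot>\<^bsub>DS\<^esub> T x) i"
      unfolding smult_DS_component[OF i]
      by (intro cinner_ext)
        (use x i in \<open>simp_all add: T_component_closed cinner_T_component cinner_smult_left sum_distrib_left\<close>)
  qed (use x in \<open>simp_all add: T_closed\<close>)
  fix y assume y: "y \<in> carrier DS"
  show "T (x \<oplus>\<^bsub>DS\<^esub> y) = T x \<oplus>\<^bsub>DS\<^esub> T y"
  proof (rule DS_ext)
    fix i assume i: "i \<in> {1..n}"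
    interpret pre_hilbert "H i" by (rule pre_hilbert[OF i])
    have "cinner (H i) (E i j ((x \<oplus>\<^bsub>DS\<^esub> y) j)) z = cinner (H i) (E i j (x j)) z + cinner (H i) (E i j (y j)) z"
      if "j \<in> {1..n}" "z \<in> carrier (H i)" for j z
      using bounded_operator.op_add[OF entry_bounded_operator[OF i that(1)]
          DS_component[OF x that(1)] DS_component[OF y that(1)]]
        entry_closed[OF i that(1) x] entry_closed[OF i that(1) y] that
      by (simp add: add_DS_component cinner_add_left)
    then show "T (x \<oplus>\<^bsub>DS\<^esub> y) i = (T x \<oplus>\<^bsub>DS\<^esub> T y) i"
      unfolding add_DS_component[OF i]
      by (intro cinner_ext)
        (use x y i in \<open>simp_all add: T_component_closed cinner_T_component cinner_add_left sum.distrib\<close>)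
  qed (use x y in \<open>simp_all add: T_closed\<close>)
next
  have "\<exists>C>0. \<forall>x\<in>carrier (H j). hnorm (H i) (E i j x) \<le> C * hnorm (H j) x"
    if "i \<in> {1..n}" "j \<in> {1..n}" for i j
    using bounded_operator.op_bound[OF entry_bounded_operator[OF that]] by metis
  then obtain C where C: "\<And>i j. \<lbrakk>i \<in> {1..n}; j \<in> {1..n}\<rbrakk> \<Longrightarrow> C i j > 0"
    "\<And>i j x. \<lbrakk>i \<in> {1..n}; j \<in> {1..n}; x \<in> carrier (H j)\<rbrakk> \<Longrightarrow> hnorm (H i) (E i j x) \<le> C i j * hnorm (H j) x"
    by metis
  have "hnorm DS (T x) \<le> (\<Sum>i\<in>{1..n}. \<Sum>j\<in>{1..n}. C i j) * hnorm DS x" if x: "x \<in> carrier DS" for x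
  proof -
    have "hnorm DS (T x) \<le> (\<Sum>i\<in>{1..n}. hnorm (H i) (T x i))"
      by (rule hnorm_DS_le_sum[OF T_closed[OF x]])
    also have "\<dots> \<le> (\<Sum>i\<in>{1..n}. \<Sum>j\<in>{1..n}. C i j * hnorm DS x)"
    proof (rule sum_mono)
      fix i assume i: "i \<in> {1..n}"
      interpret pre_hilbert "H i" by (rule pre_hilbert[OF i])
      have "hnorm (H i) (T x i) \<le> (\<Sum>j\<in>{1..n}. hnorm (H i) (E i j (x j)))"
        unfolding T_component[OF i] using entry_closed[OF i _ x] by (intro hnorm_finsum_le) auto
      also have "\<dots> \<le> (\<Sum>j\<in>{1..n}. C i j * hnorm DS x)"
      proof (rule sum_mono)
        fix j assume j: "j \<in> {1..n}"
        show "hnorm (H i) (E i j (x j)) \<le> C i j * hnorm DS x"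
          using C(2)[OF i j DS_component[OF x j]] mult_left_mono[OF hnorm_component_le[OF x j], of "C i j"]
            C(1)[OF i j] by linarith
      qed
      finally show "hnorm (H i) (T x i) \<le> (\<Sum>j\<in>{1..n}. C i j * hnorm DS x)" .
    qed
    finally show ?thesis by (simp add: sum_distrib_right)
  qed
  then show "\<exists>C. \<forall>x\<in>carrier DS. hnorm DS (T x) \<le> C * hnorm DS x" by blast
qed

sublocale T: bounded_operator DS DS T
  by (intro bounded_operator.intro bounded_operator_axioms.intro DS_complex_hilbert_space T_bounded)

lemma T_upper_semi_fredholm_iff:
  "T \<in> upper_semi_fredholm DS \<longleftrightarrow> cauchy_reflecting DS DS T"
  by (rule upper_semi_fredholm_iff[OF DS_complex_hilbert_space T_bounded])

text \<open>
  The \<open>k\<close>-th column of the block operator.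
\<close>

lemma T_embed:
  assumes k: "k \<in> {1..n}" and l: "l \<in> {1..n}" and y: "y \<in> carrier (H k)"
  shows "T (embed k y) l = E l k y"
proof -
  interpret pre_hilbert "H l" by (rule pre_hilbert[OF l])
  have entry: "E l j (embed k y j) = (if j = k then E l k y else \<zero>\<^bsub>H l\<^esub>)" if "j \<in> {1..n}" for j
    using bounded_operator.op_zero[OF entry_bounded_operator[OF l that]] that
    by (simp add: embed_component)
  have "E l k y \<in> carrier (H l)" by (rule bounded_operator.op_closed[OF entry_bounded_operator[OF l k] y])
  moreover have "cinner (H l) (T (embed k y) l) z = cinner (H l) (E l k y) z"
    if "z \<in> carrier (H l)" for z
  proof -
    have "cinner (H l) (T (embed k y) l) z = (\<Sum>j\<in>{1..n}. if j = k then cinner (H l) (E l k y) z else 0)"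
      unfolding cinner_T_component[OF embed_closed[OF k y] l that]
      using that by (intro sum.cong refl) (simp add: entry)
    then show ?thesis using k by simp
  qed
  ultimately show ?thesis
    by (intro cinner_ext T_component_closed embed_closed k l y)
qed

section \<open>Necessity\<close>

text \<open>
  A bounded sequence \<open>x\<close> in \<open>H k\<close> with \<open>D k x\<close> Cauchy is the \<open>k\<close>-th component of a sequence with Cauchy image
  under the block operator: the entries above \<open>D k x\<close> are repaired row by row, upwards, since each \<open>D i\<close> with
  \<open>i < k\<close> is onto up to finitely many dimensions, and changing the \<open>i\<close>-th component does not affect the rows
  below the \<open>i\<close>-th.
\<close>

lemma diagonal_entry_cauchy_reflecting:
  assumes T: "cauchy_reflecting DS DS T" and k: "k \<in> {1..n}"
    and closed: "\<And>i. i \<in> {1..<k} \<Longrightarrow> closed_in (H i) (D i ` carrier (H i))"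
    and fin: "\<And>i. i \<in> {1..<k} \<Longrightarrow> \<not> cinfinite (hilbert_dim (H i) (orth_complement (H i) (D i ` carrier (H i))))"
  shows "cauchy_reflecting (H k) (H k) (D k)"
  unfolding cauchy_reflecting_def
proof (intro allI impI)
  fix x assume x: "hbounded (H k) x" and Dx: "hcauchy (H k) (\<lambda>m. D k (x m))"
  \<comment> \<open>The rows from the \<open>i\<close>-th downwards are already Cauchy.\<close>
  define P where "P i \<longleftrightarrow> (\<exists>(r::nat \<Rightarrow> nat) Z. strict_mono r \<and> hbounded DS Z \<and> (\<forall>m. Z m k = x (r m))
      \<and> (\<forall>l\<in>{i..n}. hcauchy (H l) (\<lambda>m. T (Z m) l)))" for i
  have "P 1"
  proof (rule inc_induct[of 1 k])
    show "1 \<le> k" using k by simp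
    show "P k"
      unfolding P_def
    proof (intro exI conjI allI ballI)
      show "strict_mono (\<lambda>m::nat. m)" by (simp add: strict_mono_def)
      show "hbounded DS (\<lambda>m. embed k (x m))" by (rule hbounded_embed[OF k x])
      show "embed k (x m) k = x m" for m using k by (simp add: embed_component)
      fix l assume l: "l \<in> {k..n}"
      then have l': "l \<in> {1..n}" using k by simp
      interpret pre_hilbert "H l" by (rule pre_hilbert[OF l'])
      show "hcauchy (H l) (\<lambda>m. T (embed k (x m)) l)"
        using l Dx unfolding T_embed[OF k l' hboundedD[OF x]]
        by (cases "l = k") (auto simp: upper_entry_def)
    qed
  next
    fix i assume ik: "1 \<le> i" "i < k" and "P (Suc i)"
    then have i: "i \<in> {1..n}" "i \<in> {1..<k}" using k by auto
    obtain r :: "nat \<Rightarrow> nat" and Z where r: "strict_mono r" and Z: "hbounded DS Z"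
      and Xk: "\<And>m. Z m k = x (r m)" and rows: "\<And>l. l \<in> {Suc i..n} \<Longrightarrow> hcauchy (H l) (\<lambda>m. T (Z m) l)"
      using \<open>P (Suc i)\<close> unfolding P_def by blast
    note Xc = hboundedD[OF Z]
    interpret Hi: complex_hilbert_space "H i" by (rule hilbert[OF i(1)])
    interpret Di: bounded_operator "H i" "H i" "D i"
      by (intro bounded_operator.intro bounded_operator_axioms.intro hilbert diagonal i(1))
    have "hbounded (H i) (\<lambda>m. T (Z m) i)"
      by (rule hbounded_component[OF T.op_hbounded[OF Z] i(1)])
    then obtain r' :: "nat \<Rightarrow> nat" and y where r': "strict_mono r'" and y: "hbounded (H i) y"
      and rowi: "hcauchy (H i) (\<lambda>m. T (Z (r' m)) i \<oplus>\<^bsub>H i\<^esub> D i (y m))"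
      using Di.bounded_correction[OF closed[OF i(2)] fin[OF i(2)]] by blast
    define Z' where "Z' m = Z (r' m) \<oplus>\<^bsub>DS\<^esub> embed i (y m)" for m
    have yc: "embed i (y m) \<in> carrier DS" for m by (rule embed_closed[OF i(1) hboundedD[OF y]])
    have TX': "T (Z' m) l = T (Z (r' m)) l \<oplus>\<^bsub>H l\<^esub> E l i (y m)" if l: "l \<in> {1..n}" for m l
      unfolding Z'_def T.op_add[OF Xc yc] add_DS_component[OF l] T_embed[OF i(1) l hboundedD[OF y]] ..
    show "P i"
      unfolding P_def
    proof (intro exI conjI allI ballI)
      show "strict_mono (r \<circ> r')" by (rule strict_mono_o[OF r r'])
      show "hbounded DS Z'"
        unfolding Z'_def
        using pre.hbounded_add[OF hbounded_subseq[OF Z] hbounded_embed[OF i(1) y]] by (simp add: o_def)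
      show "Z' m k = x ((r \<circ> r') m)" for m
      proof -
        interpret pre_hilbert "H k" by (rule pre_hilbert[OF k])
        show ?thesis
          unfolding Z'_def add_DS_component[OF k] embed_component[OF k] Xk
          using ik hboundedD[OF x] by simp
      qed
      fix l assume l: "l \<in> {i..n}"
      then have l': "l \<in> {1..n}" using i by simp
      show "hcauchy (H l) (\<lambda>m. T (Z' m) l)"
      proof (cases "l = i")
        case True
        then show ?thesis using rowi unfolding TX'[OF l'] by (simp add: upper_entry_def)
      next
        case False
        then have li: "l \<in> {Suc i..n}" "i < l" using l by auto
        interpret pre_hilbert "H l" by (rule pre_hilbert[OF l'])
        have "T (Z' m) l = T (Z (r' m)) l" for m
          unfolding TX'[OF l'] using li T_component_closed[OF Xc l'] by (simp add: upper_entry_def)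
        then show ?thesis using hcauchy_subseq[OF rows[OF li(1)] r'] by (simp add: o_def)
      qed
    qed
  qed
  then obtain r :: "nat \<Rightarrow> nat" and Z where r: "strict_mono r" and Z: "hbounded DS Z"
    and Xk: "\<And>m. Z m k = x (r m)" and rows: "\<And>l. l \<in> {1..n} \<Longrightarrow> hcauchy (H l) (\<lambda>m. T (Z m) l)"
    unfolding P_def by blast
  have "hcauchy DS (\<lambda>m. T (Z m))"
    using rows T_closed hboundedD[OF Z] by (simp add: hcauchy_DS_iff)
  then obtain r' :: "nat \<Rightarrow> nat" where r': "strict_mono r'" "hcauchy DS (Z \<circ> r')"
    using T Z unfolding cauchy_reflecting_def by blast
  have "hcauchy (H k) (x \<circ> (r \<circ> r'))"
    using hcauchy_component[OF r'(2) k] Xk by (simp add: o_def)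
  then show "\<exists>r::nat \<Rightarrow> nat. strict_mono r \<and> hcauchy (H k) (x \<circ> r)"
    using strict_mono_o[OF r r'(1)] by blast
qed

end

section \<open>Sufficiency\<close>

text \<open>
  The block operator has the entries \<open>J s\<close> directly above the diagonal and is otherwise diagonal.
  If these entries map into the orthogonal complements of the ranges in their rows, a Cauchy
  image of the block operator splits into Cauchy sequences \<open>D s x\<^sub>s\<close> and \<open>J s x\<^sub>s\<close>.
\<close>

lemma (in hilbert_family) superdiagonal_cauchy_reflecting:
  assumes D: "\<And>s. s \<in> {1..n} \<Longrightarrow> D s \<in> bounded_ops (H s) (H s)"
    and J: "\<And>s. s \<in> {2..n} \<Longrightarrow> J s \<in> bounded_ops (H s) (H (s - 1))"
    and orth: "\<And>s x y. \<lbrakk>s \<in> {2..n}; x \<in> carrier (H (s - 1)); y \<in> carrier (H s)\<rbrakk>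
      \<Longrightarrow> cinner (H (s - 1)) (D (s - 1) x) (J s y) = 0"
    and reflecting: "\<And>s x. \<lbrakk>s \<in> {1..n}; hbounded (H s) x; hcauchy (H s) (\<lambda>m. D s (x m));
        s \<noteq> 1 \<Longrightarrow> hcauchy (H (s - 1)) (\<lambda>m. J s (x m))\<rbrakk>
      \<Longrightarrow> \<exists>r::nat \<Rightarrow> nat. strict_mono r \<and> hcauchy (H s) (x \<circ> r)"
  shows "\<exists>A\<in>block_tuples n H. upper_block_operator n H D A \<in> upper_semi_fredholm (direct_sum n H)"
proof -
  define A where "A i j = (if j = Suc i then J j else (\<lambda>x. \<zero>\<^bsub>H i\<^esub>))" for i j
  have "A i j \<in> bounded_ops (H j) (H i)" if ij: "1 \<le> i" "i < j" "j \<le> n" for i j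
  proof (cases "j = Suc i")
    case True
    then show ?thesis using J[of j] ij by (simp add: A_def)
  next
    case False
    have "i \<in> {1..n}" using ij by simp
    then show ?thesis
      using pre_hilbert.zero_operator_bounded[OF pre_hilbert] False by (simp add: A_def)
  qed
  then have A: "A \<in> block_tuples n H" by (simp add: block_tuples_def)
  interpret block_operator n H D A
    by (intro block_operator.intro block_operator_axioms.intro hilbert_family_axioms D A)
  have Jc: "J s x \<in> carrier (H (s - 1))" if "s \<in> {2..n}" "x \<in> carrier (H s)" for s x
    using J[OF that(1)] that(2) by (auto simp: bounded_ops_def)
  have Dc: "D s x \<in> carrier (H s)" if "s \<in> {1..n}" "x \<in> carrier (H s)" for s x
    using D[OF that(1)] that(2) by (auto simp: bounded_ops_def)
  have row: "T x i = D i (x i) \<oplus>\<^bsub>H i\<^esub> J (Suc i) (x (Suc i))"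
    if x: "x \<in> carrier DS" and i: "i \<in> {1..<n}" for x i
  proof -
    have i': "i \<in> {1..n}" "Suc i \<in> {2..n}" "Suc i \<in> {1..n}" using i by auto
    interpret pre_hilbert "H i" by (rule pre_hilbert[OF i'(1)])
    note c = Dc[OF i'(1) DS_component[OF x i'(1)]] Jc[OF i'(2) DS_component[OF x i'(3)], simplified]
    show ?thesis
    proof (rule cinner_ext)
      fix z assume z: "z \<in> carrier (H i)"
      have "cinner (H i) (T x i) z = (\<Sum>j\<in>{1..n}. (if j = i then cinner (H i) (D i (x i)) z else 0)
          + (if j = Suc i then cinner (H i) (J (Suc i) (x (Suc i))) z else 0))"
        unfolding cinner_T_component[OF x i'(1) z]
        using z by (intro sum.cong refl) (auto simp: upper_entry_def A_def)
      then show "cinner (H i) (T x i) z = cinner (H i) (D i (x i) \<oplus>\<^bsub>H i\<^esub> J (Suc i) (x (Suc i))) z"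
        using i' c z by (simp add: sum.distrib cinner_add_left)
    qed (use T_component_closed[OF x i'(1)] c in auto)
  qed
  have last_row: "T x n = D n (x n)" if x: "x \<in> carrier DS" and n: "n \<in> {1..n}" for x
  proof -
    interpret pre_hilbert "H n" by (rule pre_hilbert[OF n])
    note c = Dc[OF n DS_component[OF x n]]
    show ?thesis
    proof (rule cinner_ext)
      fix z assume z: "z \<in> carrier (H n)"
      have "cinner (H n) (T x n) z = (\<Sum>j\<in>{1..n}. if j = n then cinner (H n) (D n (x n)) z else 0)"
        unfolding cinner_T_component[OF x n z]
        using z by (intro sum.cong refl) (auto simp: upper_entry_def)
      then show "cinner (H n) (T x n) z = cinner (H n) (D n (x n)) z" using n by simp
    qed (use T_component_closed[OF x n] c in auto)
  qed
  have "cauchy_reflecting DS DS T"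
    unfolding cauchy_reflecting_def
  proof (intro allI impI)
    fix Z assume Z: "hbounded DS Z" and TX: "hcauchy DS (\<lambda>m. T (Z m))"
    note Xc = hboundedD[OF Z]
    have split: "hcauchy (H i) (\<lambda>m. D i (Z m i)) \<and> hcauchy (H i) (\<lambda>m. J (Suc i) (Z m (Suc i)))"
      if i: "i \<in> {1..<n}" for i
    proof -
      have i': "i \<in> {1..n}" "Suc i \<in> {2..n}" "Suc i \<in> {1..n}" using i by auto
      interpret pre_hilbert "H i" by (rule pre_hilbert[OF i'(1)])
      have "hcauchy (H i) (\<lambda>m. D i (Z m i) \<oplus>\<^bsub>H i\<^esub> J (Suc i) (Z m (Suc i)))"
        using hcauchy_component[OF TX i'(1)] row[OF Xc i] by simp
      from hcauchy_orthogonal_summands[OF this] show ?thesis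
        using Dc[OF i'(1) DS_component[OF Xc i'(1)]] Jc[OF i'(2) DS_component[OF Xc i'(3)]]
          orth[OF i'(2)] DS_component[OF Xc i'(1)] DS_component[OF Xc i'(3)] by simp
    qed
    have DX: "hcauchy (H s) (\<lambda>m. D s (Z m s))" if s: "s \<in> {1..n}" for s
    proof (cases "s = n")
      case True
      then show ?thesis using hcauchy_component[OF TX s] last_row[OF Xc] s by simp
    next
      case False
      then show ?thesis using split[of s] s by simp
    qed
    have JX: "hcauchy (H (s - 1)) (\<lambda>m. J s (Z m s))" if "s \<in> {1..n}" "s \<noteq> 1" for s
    proof -
      have "s - 1 \<in> {1..<n}" using that by auto
      from split[OF this] show ?thesis using that by simp
    qed
    have "\<exists>r::nat \<Rightarrow> nat. strict_mono r \<and> (\<forall>s\<in>{1..n}. hcauchy (H s) (\<lambda>m. Z (r m) s))"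
    proof (rule common_subsequence)
      fix s and r :: "nat \<Rightarrow> nat" assume s: "s \<in> {1..n}" and r: "strict_mono r"
      have "\<exists>r'::nat \<Rightarrow> nat. strict_mono r' \<and> hcauchy (H s) ((\<lambda>m. Z (r m) s) \<circ> r')"
      proof (rule reflecting[OF s])
        show "hbounded (H s) (\<lambda>m. Z (r m) s)"
          using hbounded_component[OF hbounded_subseq[OF Z] s] by (simp add: o_def)
        show "hcauchy (H s) (\<lambda>m. D s (Z (r m) s))"
          using hcauchy_subseq[OF DX[OF s] r] by (simp add: o_def)
        show "hcauchy (H (s - 1)) (\<lambda>m. J s (Z (r m) s))" if "s \<noteq> 1"
          using hcauchy_subseq[OF JX[OF s that] r] by (simp add: o_def)
      qed
      then show "\<exists>r'::nat \<Rightarrow> nat. strict_mono r' \<and> hcauchy (H s) (\<lambda>m. Z ((r \<circ> r') m) s)"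
        by (simp add: o_def)
    next
      show "hcauchy (H s) (\<lambda>m. Z ((r \<circ> r') m) s)"
        if "hcauchy (H s) (\<lambda>m. Z (r m) s)" "strict_mono r'" for s and r r' :: "nat \<Rightarrow> nat"
        using hcauchy_subseq[OF that] by (simp add: o_def)
    qed simp
    then show "\<exists>r::nat \<Rightarrow> nat. strict_mono r \<and> hcauchy DS (Z \<circ> r)"
      using Xc by (auto simp: hcauchy_DS_iff o_def)
  qed
  then show ?thesis using A T_upper_semi_fredholm_iff by blast
qed

text \<open>
  With closed range, only the kernel components of a bounded sequence need to be controlled, which an operator
  that is bounded below on the kernel does.
\<close>

lemma (in bounded_operator) hcauchy_if_bounded_below_on_ker:
  assumes closed: "closed_in K (T ` carrier H)"
    and J: "bounded_operator H L J" and below: "\<And>x. x \<in> ker \<Longrightarrow> hnorm H x \<le> hnorm L (J x)"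
    and x: "hbounded H x" "hcauchy K (\<lambda>m. T (x m))" "hcauchy L (\<lambda>m. J (x m))"
  shows "hcauchy H x"
proof -
  interpret J: bounded_operator H L J by (rule J)
  obtain p where p: "hbounded H p" "\<And>m. p m \<in> ker" "hcauchy H (\<lambda>m. x m \<ominus>\<^bsub>H\<^esub> p m)"
    using closed_range_split_sequence[OF closed x(1,2)] by blast
  note xc = hboundedD[OF x(1)] and pc = hboundedD[OF p(1)]
  have eq: "J (p m) = J (x m) \<ominus>\<^bsub>L\<^esub> J (x m \<ominus>\<^bsub>H\<^esub> p m)" for m
    by (rule J.K.cinner_ext) (use xc pc in \<open>simp_all add: J.op_minus J.K.cinner_simps\<close>)
  have "hcauchy L (\<lambda>m. J (p m))"
    unfolding eq by (rule J.K.hcauchy_minus[OF x(3) J.op_hcauchy[OF p(3)]])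
  then have "hcauchy H p"
  proof (rule hcauchy_dominated)
    show "hnorm H (p m \<ominus>\<^bsub>H\<^esub> p k) \<le> 1 * hnorm L (J (p m) \<ominus>\<^bsub>L\<^esub> J (p k))" for m k
      using below[OF H.linear_subspaceD(5)[OF ker_subspace p(2) p(2)]] pc by (simp add: J.op_minus)
  qed (use pc in \<open>auto intro: J.K.pre_hilbert_axioms\<close>)
  then have "hcauchy H (\<lambda>m. (x m \<ominus>\<^bsub>H\<^esub> p m) \<oplus>\<^bsub>H\<^esub> p m)" by (rule H.hcauchy_add[OF p(3)])
  then show ?thesis using xc pc by (simp add: H.minus_add_cancel)
qed

theorem theorem3p1:
  fixes n :: nat
    and H :: "nat \<Rightarrow> 'a ip_space"
    and D :: "nat \<Rightarrow> 'a \<Rightarrow> 'a"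
  assumes "n \<ge> 2"
    and "\<forall>s\<in>{1..n}. complex_hilbert_space (H s)"
    and "\<forall>s\<in>{1..n}. cinfinite (hilbert_dim (H s) (carrier (H s)))"
    and "\<forall>s\<in>{1..n}. D s \<in> bounded_ops (H s) (H s)"
  shows
    "((D 1 \<in> upper_semi_fredholm (H 1) \<and>
       (((\<forall>s\<in>{2..n}. closed_in (H s) (op_range (H s) (D s))) \<and>
         (\<forall>s\<in>{2..n}. nullity (H s) (D s) \<le>o defect (H (s - 1)) (D (s - 1))))
        \<or> (\<forall>s\<in>{2..n}. D s \<in> upper_semi_fredholm (H s))))
      \<longrightarrow> (\<exists>A\<in>block_tuples n H.
             upper_block_operator n H D A \<in> upper_semi_fredholm (direct_sum n H)))
   \<and> ((\<exists>A\<in>block_tuples n H.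
             upper_block_operator n H D A \<in> upper_semi_fredholm (direct_sum n H))
      \<longrightarrow> (D 1 \<in> upper_semi_fredholm (H 1) \<and>
       ((\<exists>j\<in>{1..n - 1}. cinfinite (defect (H j) (D j)) \<and>
           (\<forall>s\<in>{2..j}. \<not> cinfinite (nullity (H s) (D s))))
        \<or> (\<forall>s\<in>{2..n}. D s \<in> upper_semi_fredholm (H s)))))"
proof (intro conjI impI)
  interpret hilbert_family n H by (rule hilbert_family.intro) (use assms(2) in blast)
  have D: "D s \<in> bounded_ops (H s) (H s)" if "s \<in> {1..n}" for s using assms(4) that by blast
  have op: "bounded_operator (H s) (H s) (D s)" if "s \<in> {1..n}" for s
    by (intro bounded_operator.intro bounded_operator_axioms.intro hilbert D that)
  have iff: "D s \<in> upper_semi_fredholm (H s) \<longleftrightarrow> cauchy_reflecting (H s) (H s) (D s)"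
    if "s \<in> {1..n}" for s by (rule upper_semi_fredholm_iff[OF hilbert[OF that] D[OF that]])
  have one: "1 \<in> {1..n}" using assms(1) by simp
  {
    assume i: "D 1 \<in> upper_semi_fredholm (H 1) \<and>
       (((\<forall>s\<in>{2..n}. closed_in (H s) (op_range (H s) (D s))) \<and>
         (\<forall>s\<in>{2..n}. nullity (H s) (D s) \<le>o defect (H (s - 1)) (D (s - 1))))
        \<or> (\<forall>s\<in>{2..n}. D s \<in> upper_semi_fredholm (H s)))"
    then consider (dims) "\<forall>s\<in>{2..n}. closed_in (H s) (op_range (H s) (D s))"
        "\<forall>s\<in>{2..n}. nullity (H s) (D s) \<le>o defect (H (s - 1)) (D (s - 1))"
      | (diag) "\<forall>s\<in>{2..n}. D s \<in> upper_semi_fredholm (H s)" by blast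
    then show "\<exists>A\<in>block_tuples n H.
        upper_block_operator n H D A \<in> upper_semi_fredholm (direct_sum n H)"
    proof cases
      case diag
      have "D s \<in> upper_semi_fredholm (H s)" if "s \<in> {1..n}" for s
        using diag i that by (cases "s = 1") auto
      then have refl: "cauchy_reflecting (H s) (H s) (D s)" if "s \<in> {1..n}" for s
        using iff that by blast
      show ?thesis
      proof (rule superdiagonal_cauchy_reflecting[where J = "\<lambda>s x. \<zero>\<^bsub>H (s - 1)\<^esub>"])
        fix s assume "s \<in> {2..n}"
        then have s: "s - 1 \<in> {1..n}" by auto
        interpret complex_hilbert_space "H (s - 1)" by (rule hilbert[OF s])
        show "(\<lambda>x. \<zero>\<^bsub>H (s - 1)\<^esub>) \<in> bounded_ops (H s) (H (s - 1))"
          by (rule zero_operator_bounded)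
        show "cinner (H (s - 1)) (D (s - 1) x) \<zero>\<^bsub>H (s - 1)\<^esub> = 0" if "x \<in> carrier (H (s - 1))" for x
          by (rule cinner_zero_right[OF bounded_operator.op_closed[OF op[OF s] that]])
      next
        show "\<exists>r::nat \<Rightarrow> nat. strict_mono r \<and> hcauchy (H s) (x \<circ> r)"
          if "s \<in> {1..n}" "hbounded (H s) x" "hcauchy (H s) (\<lambda>m. D s (x m))" for s x
          using refl[OF that(1)] that(2,3) unfolding cauchy_reflecting_def by blast
      qed (rule D)
    next
      case dims
      have closed: "closed_in (H s) (D s ` carrier (H s))" if "s \<in> {1..n}" for s
        using dims(1) i that by (cases "s = 1") (auto simp: upper_semi_fredholm_def op_range_def)
      have "\<exists>J. J \<in> bounded_ops (H s) (H (s - 1))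
          \<and> (\<forall>x\<in>a_kernel (H s) (H s) (D s). hnorm (H s) x \<le> hnorm (H (s - 1)) (J x))
          \<and> (\<forall>x\<in>carrier (H (s - 1)). \<forall>y\<in>carrier (H s). cinner (H (s - 1)) (D (s - 1) x) (J y) = 0)"
        if s: "s \<in> {2..n}" for s
      proof -
        have s': "s \<in> {1..n}" "s - 1 \<in> {1..n}" using s by auto
        interpret K: complex_hilbert_space "H (s - 1)" by (rule hilbert[OF s'(2)])
        interpret D': bounded_operator "H (s - 1)" "H (s - 1)" "D (s - 1)" by (rule op[OF s'(2)])
        interpret D: bounded_operator "H s" "H s" "D s" by (rule op[OF s'(1)])
        have R: "D (s - 1) ` carrier (H (s - 1)) \<subseteq> carrier (H (s - 1))" 
          using D'.op_closed by blast
        have "nullity (H s) (D s) \<le>o defect (H (s - 1)) (D (s - 1))" using dims(2) s by blast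
        then have "hilbert_dim (H s) D.ker \<le>o hilbert_dim (H (s - 1)) D'.coker_space"
          unfolding nullity_def defect_def op_range_def by (simp only: closed[OF s'(2)] if_True)
        then obtain J where J: "J \<in> bounded_ops (H s) (H (s - 1))"
          "\<And>x. x \<in> D.ker \<Longrightarrow> hnorm (H s) x \<le> hnorm (H (s - 1)) (J x)"
          "\<And>x z. \<lbrakk>x \<in> carrier (H s); z \<in> carrier (H (s - 1)); \<And>y. y \<in> D'.coker_space \<Longrightarrow> cinner (H (s - 1)) y z = 0\<rbrakk>
            \<Longrightarrow> cinner (H (s - 1)) (J x) z = 0"
          using partial_isometry_exists[OF hilbert[OF s'(1)] hilbert[OF s'(2)] D.ker_subspace D.ker_closed
              K.orth_complement_subspace[OF R]] by metis
        have "cinner (H (s - 1)) (D (s - 1) x) (J y) = 0"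
          if x: "x \<in> carrier (H (s - 1))" and y: "y \<in> carrier (H s)" for x y
        proof -
          have "J y \<in> carrier (H (s - 1))" using J(1) y by (auto simp: bounded_ops_def)
          moreover have "cinner (H (s - 1)) (J y) (D (s - 1) x) = 0"
            by (rule J(3)[OF y D'.op_closed[OF x]]) (use x in \<open>auto simp: orth_complement_def\<close>)
          ultimately show ?thesis using K.cinner_commute[of "J y" "D (s - 1) x"] D'.op_closed[OF x] by simp
        qed
        then show ?thesis using J(1,2) by blast
      qed
      then obtain J where J: "\<And>s. s \<in> {2..n} \<Longrightarrow> J s \<in> bounded_ops (H s) (H (s - 1))"
        "\<And>s x. \<lbrakk>s \<in> {2..n}; x \<in> a_kernel (H s) (H s) (D s)\<rbrakk>
          \<Longrightarrow> hnorm (H s) x \<le> hnorm (H (s - 1)) (J s x)"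
        "\<And>s x y. \<lbrakk>s \<in> {2..n}; x \<in> carrier (H (s - 1)); y \<in> carrier (H s)\<rbrakk>
          \<Longrightarrow> cinner (H (s - 1)) (D (s - 1) x) (J s y) = 0"
        by metis
      show ?thesis
      proof (rule superdiagonal_cauchy_reflecting[OF D J(1,3)])
        fix s x assume s: "s \<in> {1..n}" and x: "hbounded (H s) x" and Dx: "hcauchy (H s) (\<lambda>m. D s (x m))"
          and Jx: "s \<noteq> 1 \<Longrightarrow> hcauchy (H (s - 1)) (\<lambda>m. J s (x m))"
        show "\<exists>r::nat \<Rightarrow> nat. strict_mono r \<and> hcauchy (H s) (x \<circ> r)"
        proof (cases "s = 1")
          case True
          then show ?thesis using i iff[OF one] x Dx unfolding cauchy_reflecting_def by blast
        next
          case False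
          then have s2: "s \<in> {2..n}" "s - 1 \<in> {1..n}" using s by auto
          interpret D: bounded_operator "H s" "H s" "D s" by (rule op[OF s])
          have "bounded_operator (H s) (H (s - 1)) (J s)"
            by (intro bounded_operator.intro bounded_operator_axioms.intro hilbert J(1) s s2)
          then have "hcauchy (H s) x"
            using D.hcauchy_if_bounded_below_on_ker[OF closed[OF s] _ J(2)[OF s2(1)] x Dx Jx[OF False]]
            by blast
          moreover have "strict_mono (\<lambda>m::nat. m)" by (simp add: strict_mono_def)
          ultimately show ?thesis by (intro exI[of _ "\<lambda>m. m"]) (simp add: o_def)
        qed
      qed
    qed
  next
    assume "\<exists>A\<in>block_tuples n H. upper_block_operator n H D A \<in> upper_semi_fredholm (direct_sum n H)"
    then obtain A where A: "A \<in> block_tuples n H"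
      and T: "upper_block_operator n H D A \<in> upper_semi_fredholm (direct_sum n H)" by blast
    interpret block_operator n H D A
    by (intro block_operator.intro block_operator_axioms.intro hilbert_family_axioms D A)
    have T': "cauchy_reflecting DS DS T" using T T_upper_semi_fredholm_iff by blast
    have step: "D k \<in> upper_semi_fredholm (H k)"
      if k: "k \<in> {1..n}" and usf: "\<And>i. i \<in> {1..<k} \<Longrightarrow> D i \<in> upper_semi_fredholm (H i)"
        and fin: "\<And>i. i \<in> {1..<k} \<Longrightarrow> \<not> cinfinite (defect (H i) (D i))" for k
    proof -
      have closed: "closed_in (H i) (D i ` carrier (H i))" if "i \<in> {1..<k}" for i
        using usf[OF that] by (simp add: upper_semi_fredholm_def op_range_def)
      then have "\<not> cinfinite (hilbert_dim (H i) (orth_complement (H i) (D i ` carrier (H i))))"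
        if "i \<in> {1..<k}" for i
        using fin[OF that] that by (simp add: defect_def op_range_def)
      then show ?thesis
        unfolding iff[OF k] using closed by (intro diagonal_entry_cauchy_reflecting[OF T' k]) auto
    qed
    show D1: "D 1 \<in> upper_semi_fredholm (H 1)" using step[OF one] by simp
    show "(\<exists>j\<in>{1..n - 1}. cinfinite (defect (H j) (D j)) \<and>
           (\<forall>s\<in>{2..j}. \<not> cinfinite (nullity (H s) (D s))))
        \<or> (\<forall>s\<in>{2..n}. D s \<in> upper_semi_fredholm (H s))"
    proof (rule disjCI)
      assume "\<not> (\<forall>s\<in>{2..n}. D s \<in> upper_semi_fredholm (H s))"
      then obtain s where s: "s \<in> {2..n} \<and> D s \<notin> upper_semi_fredholm (H s)" by blast
      define k where "k = (LEAST s. s \<in> {2..n} \<and> D s \<notin> upper_semi_fredholm (H s))"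
      have k: "k \<in> {2..n}" "D k \<notin> upper_semi_fredholm (H k)"
        using LeastI[of "\<lambda>s. s \<in> {2..n} \<and> D s \<notin> upper_semi_fredholm (H s)", OF s]
        by (auto simp: k_def)
      have below: "D i \<in> upper_semi_fredholm (H i)" if "i \<in> {1..<k}" for i
      proof (cases "i = 1")
        case False
        then have "i \<in> {2..n}" using that k(1) by auto
        then show ?thesis
          using not_less_Least[of i "\<lambda>s. s \<in> {2..n} \<and> D s \<notin> upper_semi_fredholm (H s)"] that
          by (auto simp: k_def)
      qed (use D1 in simp)
      obtain j where j: "j \<in> {1..<k}" "cinfinite (defect (H j) (D j))"
        using step[of k] k below by fastforce
      have "\<not> cinfinite (nullity (H s) (D s))" if "s \<in> {2..j}" for s
        using below[of s] that j(1) by (auto simp: upper_semi_fredholm_def)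
      then show "\<exists>j\<in>{1..n - 1}. cinfinite (defect (H j) (D j)) \<and>
          (\<forall>s\<in>{2..j}. \<not> cinfinite (nullity (H s) (D s)))"
        using j k(1) by (intro bexI[of _ j]) auto
    qed
  }
qed

end
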